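(* Let $G\rightrightarrows M$ be a Lie groupoid with source $\alpha$, target $\beta$, inversion $i$ and identity section $\epsilon$, and let $(L,\mathcal{M}_c,\mathcal{D}_c)$ be a discrete nonholonomic Lagrangian system on $G$. Let $S_{(L,\mathcal{M}_c)}=dL(\mathcal{M}_c)=\{dL(g): g\in\mathcal{M}_c\}\subseteq T^*G$. Then the first step $$(S_{(L,\mathcal{M}_c)})^1_f=S_{(L,\mathcal{M}_c)}\cap\tilde\beta_{\mathcal{D}_c}^{-1}\big(\tilde\alpha_{\mathcal{D}_c}(S_{(L,\mathcal{M}_c)})\big)$$ of the forward integrability algorithm applied to $S_{(L,\mathcal{M}_c)}$ with respect to the maps $\tilde\alpha_{\mathcal{D}_c},\tilde\beta_{\mathcal{D}_c}:T^*G\to\mathcal{D}_c^*$ consists of the points $dL(g)\in S_{(L,\mathcal{M}_c)}$ (with $g\in\mathcal{M}_c$) such that there exists an element $h\in\mathcal{M}_c$ satisfying $(g,h)\in G_2$ and such that $(g,h)$ is a solution of the discrete nonholonomic Euler–Lagrange equations, that is, $$d\left[L\circ l_g+L\circ r_h\circ i\right](\epsilon(x))_{|(\mathcal{D}_c)_x}=0,\qquad x=\beta(g)=\alpha(h).$$ In other words, $$\{(g,h)\in G_2\cap(\mathcal{M}_c\times\mathcal{M}_c) : (g,h)\text{ solves the discrete nonholonomic Euler–Lagrange equations}\}$$ $$=\{(g,h)\in G_2\cap(\mathcal{M}_c\times\mathcal{M}_c):\tilde\beta_{\mathcal{D}_c}(dL(g))=\tilde\alpha_{\mathcal{D}_c}(dL(h))\},$$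 and $(S_{(L,\mathcal{M}_c)})^1_f$ is the set of the points $dL(g)$ for which there is $h$ with $(g,h)$ in this set.
   Context: For a Lie groupoid $G\rightrightarrows M$, $G_2=\{(g,h)\in G\times G:\beta(g)=\alpha(h)\}$. Translations: $l_g:\alpha^{-1}(\beta(g))\to\alpha^{-1}(\alpha(g))$, $l_g(h)=gh$, and $r_g:\beta^{-1}(\alpha(g))\to\beta^{-1}(\beta(g))$, $r_g(h)=hg$. The Lie algebroid $AG\to M$ has fibre $A_xG=\ker(T_{\epsilon(x)}\alpha)$; $A^*G$ is its dual bundle. For $(g,h)\in G_2$ with $x=\beta(g)=\alpha(h)$, the function $L\circ l_g+L\circ r_h\circ i$ is defined on $\alpha^{-1}(x)$, whose tangent space at $\epsilon(x)$ is $A_xG$. A discrete nonholonomic Lagrangian system $(L,\mathcal{M}_c,\mathcal{D}_c)$ on $G$ consists of a smooth function $L:G\to\mathbb{R}$ (the discrete Lagrangian), a vector subbundle $\mathcal{D}_c$ of $AG$ (the constraint distribution) and an embedded submanifold $\mathcal{M}_c\subseteq G$ (the discrete constraint submanifold) such that $\dim\mathcal{M}_c=\dim\mathcal{D}_c$. Its discrete nonholonomic Euler–Lagrange equations are the equations $d(L\circ l_g+L\circ r_h\circ i)(\epsilon(x))_{|(\mathcal{D}_c)_x}=0$ for $(g,h)\in G_2\cap(\mathcal{M}_c\times\mathcal{M}_c)$ with $\beta(g)=\alpha(h)=x$. Here $dL(g)\in T_g^*G$ denotes the differential at $g$ of $L$ as a function on all of $G$. The cotangent groupoid $T^*G\rightrightarrows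 A^*G$ has target and source $$\tilde\beta(\mu_g)(X)=\mu_g\big((T_{\epsilon(\beta(g))}l_g)(X)\big),\quad \mu_g\in T^*_gG,\ X\in A_{\beta(g)}G,$$ $$\tilde\alpha(\nu_h)(Y)=\nu_h\big((T_{\epsilon(\alpha(h))}r_h)(Y-(T_{\epsilon(\alpha(h))}(\epsilon\circ\beta))(Y))\big),\quad \nu_h\in T_h^*G,\ Y\in A_{\alpha(h)}G.$$ With $i_{\mathcal{D}_c}^*:A^*G\to\mathcal{D}_c^*$ the dual of the inclusion $i_{\mathcal{D}_c}:\mathcal{D}_c\to AG$, set $\tilde\alpha_{\mathcal{D}_c}=i_{\mathcal{D}_c}^*\circ\tilde\alpha$ and $\tilde\beta_{\mathcal{D}_c}=i_{\mathcal{D}_c}^*\circ\tilde\beta$. These are maps into the total space of $\mathcal{D}_c^*$, so equality of values includes equality of base points. The forward integrability algorithm is applied with $\tilde\alpha_{\mathcal{D}_c},\tilde\beta_{\mathcal{D}_c}$ playing the roles of source and target. *)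

theory Defs
  imports "HOL-Analysis.Analysis"
begin

section \<open>Smooth maps between finite-dimensional spaces\<close>

primrec Ck_on :: "nat \<Rightarrow> 'e::real_normed_vector set \<Rightarrow> ('e \<Rightarrow> 'f::real_normed_vector) \<Rightarrow> bool" where
  "Ck_on 0 S f \<longleftrightarrow> continuous_on S f"
| "Ck_on (Suc k) S f \<longleftrightarrow> (\<forall>x\<in>S. f differentiable (at x)) \<and>
     (\<forall>v. Ck_on k S (\<lambda>x. frechet_derivative f (at x) v))"

definition smooth_on :: "'e::real_normed_vector set \<Rightarrow> ('e \<Rightarrow> 'f::real_normed_vector) \<Rightarrow> bool" where
  "smooth_on S f \<longleftrightarrow> open S \<and> (\<forall>k. Ck_on k S f)"


section \<open>Smooth manifolds\<close>

text \<open>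
  The model space of a manifold is a finite-dimensional real inner product space. The class
  \<^class>\<open>euclidean_space\<close> is not used because it excludes dimension 0, and with it, for example,
  Lie groups regarded as Lie groupoids over a point; finite dimensionality is instead part of
  the definition of a manifold. A chart is a pair of a domain and a coordinate map, the latter
  being relevant on the domain only. The underlying set of a manifold is the \<^const>\<open>topspace\<close> of
  its topology. The atlas need not be maximal.
\<close>

type_synonym ('a, 'e) chart = "'a set \<times> ('a \<Rightarrow> 'e)"

record ('a, 'e) manifold =
  mtop :: "'a topology"
  atlas :: "('a, 'e) chart set"

abbreviation pts :: "('a, 'e, 'z) manifold_scheme \<Rightarrow> 'a set" where
  "pts X \<equiv> topspace (mtop X)"

definition topological_chart :: "('a, 'e::real_inner) manifold \<Rightarrow> ('a, 'e) chart \<Rightarrow> bool" where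
  "topological_chart X c \<longleftrightarrow> openin (mtop X) (fst c) \<and> open (snd c ` fst c) \<and>
     homeomorphic_map (subtopology (mtop X) (fst c)) (top_of_set (snd c ` fst c)) (snd c)"

definition compatible_charts :: "('a, 'e::real_inner) chart \<Rightarrow> ('a, 'e) chart \<Rightarrow> bool" where
  "compatible_charts c d \<longleftrightarrow>
     smooth_on (snd c ` (fst c \<inter> fst d)) (snd d \<circ> inv_into (fst c) (snd c)) \<and>
     smooth_on (snd d ` (fst c \<inter> fst d)) (snd c \<circ> inv_into (fst d) (snd d))"

definition smooth_manifold :: "('a, 'e::real_inner) manifold \<Rightarrow> bool" where
  "smooth_manifold X \<longleftrightarrow>
     (\<exists>B::'e set. finite B \<and> span B = UNIV) \<and>
     Hausdorff_space (mtop X) \<and> second_countable (mtop X) \<and>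
     (\<Union>c\<in>atlas X. fst c) = pts X \<and>
     (\<forall>c\<in>atlas X. topological_chart X c) \<and>
     (\<forall>c\<in>atlas X. \<forall>d\<in>atlas X. compatible_charts c d)"

text \<open>The charts of the maximal atlas.\<close>

definition smooth_chart :: "('a, 'e::real_inner) manifold \<Rightarrow> ('a, 'e) chart \<Rightarrow> bool" where
  "smooth_chart X c \<longleftrightarrow> topological_chart X c \<and> (\<forall>d\<in>atlas X. compatible_charts c d)"

definition vector_manifold :: "('e::real_inner, 'e) manifold" where
  "vector_manifold = \<lparr>mtop = euclidean, atlas = {(UNIV, id)}\<rparr>"

definition product_manifold ::
  "('a, 'e::real_inner) manifold \<Rightarrow> ('b, 'f::real_inner) manifold \<Rightarrow> ('a \<times> 'b, 'e \<times> 'f) manifold" where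
  "product_manifold X Y = \<lparr>mtop = prod_topology (mtop X) (mtop Y),
     atlas = {(fst c \<times> fst d, map_prod (snd c) (snd d)) | c d. c \<in> atlas X \<and> d \<in> atlas Y}\<rparr>"

definition in_charts :: "('a, 'e) chart \<Rightarrow> ('b, 'f) chart \<Rightarrow> ('a \<Rightarrow> 'b) \<Rightarrow> 'e \<Rightarrow> 'f" where
  "in_charts c d f = snd d \<circ> f \<circ> inv_into (fst c) (snd c)"

definition smooth_map_open :: "('a, 'e::real_inner) manifold \<Rightarrow> ('b, 'f::real_inner) manifold \<Rightarrow>
    'a set \<Rightarrow> ('a \<Rightarrow> 'b) \<Rightarrow> bool" where
  "smooth_map_open X Y W f \<longleftrightarrow> openin (mtop X) W \<and>
     continuous_map (subtopology (mtop X) W) (mtop Y) f \<and>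
     (\<forall>c\<in>atlas X. \<forall>d\<in>atlas Y. smooth_on (snd c ` (fst c \<inter> W \<inter> f -` fst d)) (in_charts c d f))"

text \<open>
  Smoothness on an arbitrary subset means local extendability to smooth maps on open sets. On
  an open set this is ordinary smoothness, and on an embedded submanifold it is smoothness with
  respect to the induced manifold structure.
\<close>

definition smooth_map :: "('a, 'e::real_inner) manifold \<Rightarrow> ('b, 'f::real_inner) manifold \<Rightarrow>
    'a set \<Rightarrow> ('a \<Rightarrow> 'b) \<Rightarrow> bool" where
  "smooth_map X Y S f \<longleftrightarrow> S \<subseteq> pts X \<and>
     (\<forall>p\<in>S. \<exists>W F. p \<in> W \<and> smooth_map_open X Y W F \<and> (\<forall>q\<in>S \<inter> W. F q = f q))"

text \<open>
  The tangent space at a point \<open>p\<close> is identified with the model space by means of a chart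
  around \<open>p\<close> that is chosen once and for all, so that tangent vectors at \<open>p\<close> are elements of the
  model space. For a map defined on an embedded submanifold \<open>S\<close> the tangent map is the derivative
  within \<open>S\<close>; only its values on vectors tangent to \<open>S\<close> are meaningful (and uniquely determined).
  If \<open>S\<close> is open it is the ordinary tangent map.
\<close>

definition chart_at :: "('a, 'e) manifold \<Rightarrow> 'a \<Rightarrow> ('a, 'e) chart" where
  "chart_at X p = (SOME c. c \<in> atlas X \<and> p \<in> fst c)"

definition tangent_map :: "('a, 'e::real_inner) manifold \<Rightarrow> ('b, 'f::real_inner) manifold \<Rightarrow>
    'a set \<Rightarrow> ('a \<Rightarrow> 'b) \<Rightarrow> 'a \<Rightarrow> 'e \<Rightarrow> 'f" where
  "tangent_map X Y S f p =
     (let c = chart_at X p; d = chart_at Y (f p)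
      in frechet_derivative (in_charts c d f) (at (snd c p) within snd c ` (fst c \<inter> S)))"

text \<open>For real-valued functions; tangent spaces of \<open>\<real>\<close> are \<open>\<real>\<close> via the identity chart.\<close>

abbreviation differential ::
  "('a, 'e::real_inner) manifold \<Rightarrow> 'a set \<Rightarrow> ('a \<Rightarrow> real) \<Rightarrow> 'a \<Rightarrow> 'e \<Rightarrow> real" where
  "differential X S f p \<equiv> tangent_map X vector_manifold S f p"

definition submersion ::
  "('a, 'e::real_inner) manifold \<Rightarrow> ('b, 'f::real_inner) manifold \<Rightarrow> ('a \<Rightarrow> 'b) \<Rightarrow> bool" where
  "submersion X Y f \<longleftrightarrow> smooth_map X Y (pts X) f \<and>
     (\<forall>p\<in>pts X. surj (tangent_map X Y (pts X) f p))"

definition embedded_submanifold ::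
  "('a, 'e::real_inner) manifold \<Rightarrow> nat \<Rightarrow> 'a set \<Rightarrow> bool" where
  "embedded_submanifold X k S \<longleftrightarrow> S \<subseteq> pts X \<and>
     (\<forall>p\<in>S. \<exists>c E. smooth_chart X c \<and> p \<in> fst c \<and> subspace E \<and> dim E = k \<and>
        snd c ` (fst c \<inter> S) = snd c ` fst c \<inter> E)"


section \<open>Lie groupoids\<close>

text \<open>The product \<open>gh\<close> is defined when the target of \<open>g\<close> is the source of \<open>h\<close>.\<close>

record ('g, 'e, 'm, 'f) groupoid =
  arrows :: "('g, 'e) manifold"
  objects :: "('m, 'f) manifold"
  src :: "'g \<Rightarrow> 'm"
  tgt :: "'g \<Rightarrow> 'm"
  ident :: "'m \<Rightarrow> 'g"
  inv_arr :: "'g \<Rightarrow> 'g"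
  mult :: "'g \<Rightarrow> 'g \<Rightarrow> 'g"

definition composable :: "('g, 'e, 'm, 'f) groupoid \<Rightarrow> ('g \<times> 'g) set" where
  "composable \<Gamma> = {(g, h). g \<in> pts (arrows \<Gamma>) \<and> h \<in> pts (arrows \<Gamma>) \<and> tgt \<Gamma> g = src \<Gamma> h}"

definition is_groupoid :: "('g, 'e, 'm, 'f) groupoid \<Rightarrow> bool" where
  "is_groupoid \<Gamma> \<longleftrightarrow>
     src \<Gamma> \<in> pts (arrows \<Gamma>) \<rightarrow> pts (objects \<Gamma>) \<and>
     tgt \<Gamma> \<in> pts (arrows \<Gamma>) \<rightarrow> pts (objects \<Gamma>) \<and>
     ident \<Gamma> \<in> pts (objects \<Gamma>) \<rightarrow> pts (arrows \<Gamma>) \<and>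
     inv_arr \<Gamma> \<in> pts (arrows \<Gamma>) \<rightarrow> pts (arrows \<Gamma>) \<and>
     (\<forall>(g, h)\<in>composable \<Gamma>. mult \<Gamma> g h \<in> pts (arrows \<Gamma>) \<and>
        src \<Gamma> (mult \<Gamma> g h) = src \<Gamma> g \<and> tgt \<Gamma> (mult \<Gamma> g h) = tgt \<Gamma> h) \<and>
     (\<forall>g h k. (g, h) \<in> composable \<Gamma> \<and> (h, k) \<in> composable \<Gamma> \<longrightarrow>
        mult \<Gamma> (mult \<Gamma> g h) k = mult \<Gamma> g (mult \<Gamma> h k)) \<and>
     (\<forall>x\<in>pts (objects \<Gamma>). src \<Gamma> (ident \<Gamma> x) = x \<and> tgt \<Gamma> (ident \<Gamma> x) = x) \<and>
     (\<forall>g\<in>pts (arrows \<Gamma>).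
        mult \<Gamma> (ident \<Gamma> (src \<Gamma> g)) g = g \<and> mult \<Gamma> g (ident \<Gamma> (tgt \<Gamma> g)) = g \<and>
        src \<Gamma> (inv_arr \<Gamma> g) = tgt \<Gamma> g \<and> tgt \<Gamma> (inv_arr \<Gamma> g) = src \<Gamma> g \<and>
        mult \<Gamma> g (inv_arr \<Gamma> g) = ident \<Gamma> (src \<Gamma> g) \<and>
        mult \<Gamma> (inv_arr \<Gamma> g) g = ident \<Gamma> (tgt \<Gamma> g))"

definition lie_groupoid ::
  "('g, 'e::real_inner, 'm, 'f::real_inner) groupoid \<Rightarrow> bool" where
  "lie_groupoid \<Gamma> \<longleftrightarrow>
     smooth_manifold (arrows \<Gamma>) \<and> smooth_manifold (objects \<Gamma>) \<and> is_groupoid \<Gamma> \<and>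
     submersion (arrows \<Gamma>) (objects \<Gamma>) (src \<Gamma>) \<and>
     submersion (arrows \<Gamma>) (objects \<Gamma>) (tgt \<Gamma>) \<and>
     smooth_map (objects \<Gamma>) (arrows \<Gamma>) (pts (objects \<Gamma>)) (ident \<Gamma>) \<and>
     smooth_map (arrows \<Gamma>) (arrows \<Gamma>) (pts (arrows \<Gamma>)) (inv_arr \<Gamma>) \<and>
     smooth_map (product_manifold (arrows \<Gamma>) (arrows \<Gamma>)) (arrows \<Gamma>)
       (composable \<Gamma>) (\<lambda>(g, h). mult \<Gamma> g h)"

definition src_fibre :: "('g, 'e, 'm, 'f) groupoid \<Rightarrow> 'm \<Rightarrow> 'g set" where
  "src_fibre \<Gamma> x = {g \<in> pts (arrows \<Gamma>). src \<Gamma> g = x}"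

definition tgt_fibre :: "('g, 'e, 'm, 'f) groupoid \<Rightarrow> 'm \<Rightarrow> 'g set" where
  "tgt_fibre \<Gamma> x = {g \<in> pts (arrows \<Gamma>). tgt \<Gamma> g = x}"

text \<open>
  Translations; they are regarded as maps on \<open>src_fibre \<Gamma> (tgt \<Gamma> g)\<close> and
  \<open>tgt_fibre \<Gamma> (src \<Gamma> h)\<close>, respectively.
\<close>

definition ltrans :: "('g, 'e, 'm, 'f) groupoid \<Rightarrow> 'g \<Rightarrow> 'g \<Rightarrow> 'g" where
  "ltrans \<Gamma> g k = mult \<Gamma> g k"

definition rtrans :: "('g, 'e, 'm, 'f) groupoid \<Rightarrow> 'g \<Rightarrow> 'g \<Rightarrow> 'g" where
  "rtrans \<Gamma> h k = mult \<Gamma> k h"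


section \<open>The Lie algebroid and its vector subbundles\<close>

definition algebroid_fibre ::
  "('g, 'e::real_inner, 'm, 'f::real_inner) groupoid \<Rightarrow> 'm \<Rightarrow> 'e set" where
  "algebroid_fibre \<Gamma> x =
     {v. tangent_map (arrows \<Gamma>) (objects \<Gamma>) (pts (arrows \<Gamma>)) (src \<Gamma>) (ident \<Gamma> x) v = 0}"

text \<open>
  The chosen chart at \<open>ident \<Gamma> y\<close> need not depend continuously on \<open>y\<close>; smoothness of a section
  is therefore expressed by its components \<open>T\<phi>(s(y))\<close> with respect to each fixed chart \<open>\<phi>\<close>.
\<close>

definition smooth_section ::
  "('g, 'e::real_inner, 'm, 'f::real_inner) groupoid \<Rightarrow> 'm set \<Rightarrow> ('m \<Rightarrow> 'e) \<Rightarrow> bool" where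
  "smooth_section \<Gamma> W s \<longleftrightarrow> (\<forall>y\<in>W. s y \<in> algebroid_fibre \<Gamma> y) \<and>
     (\<forall>c\<in>atlas (arrows \<Gamma>). smooth_map (objects \<Gamma>) vector_manifold {y \<in> W. ident \<Gamma> y \<in> fst c}
        (\<lambda>y. tangent_map (arrows \<Gamma>) vector_manifold (fst c) (snd c) (ident \<Gamma> y) (s y)))"

definition vector_subbundle ::
  "('g, 'e::real_inner, 'm, 'f::real_inner) groupoid \<Rightarrow> nat \<Rightarrow> ('m \<Rightarrow> 'e set) \<Rightarrow> bool" where
  "vector_subbundle \<Gamma> r D \<longleftrightarrow>
     (\<forall>x\<in>pts (objects \<Gamma>). subspace (D x) \<and> D x \<subseteq> algebroid_fibre \<Gamma> x \<and> dim (D x) = r) \<and>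
     (\<forall>x\<in>pts (objects \<Gamma>). \<exists>W (s :: nat \<Rightarrow> 'm \<Rightarrow> 'e). openin (mtop (objects \<Gamma>)) W \<and> x \<in> W \<and>
        (\<forall>j<r. smooth_section \<Gamma> W (s j)) \<and> (\<forall>y\<in>W. D y = span ((\<lambda>j. s j y) ` {..<r})))"


section \<open>Discrete nonholonomic Lagrangian systems\<close>

text \<open>
  The total space of a rank \<open>r\<close> vector bundle over the object manifold has dimension
  \<open>dim M + r\<close>.
\<close>

definition discrete_nonholonomic_system ::
  "('g, 'e::real_inner, 'm, 'f::real_inner) groupoid \<Rightarrow>
     ('g \<Rightarrow> real) \<Rightarrow> 'g set \<Rightarrow> ('m \<Rightarrow> 'e set) \<Rightarrow> bool" where
  "discrete_nonholonomic_system \<Gamma> L Mc Dc \<longleftrightarrow>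
     smooth_map (arrows \<Gamma>) vector_manifold (pts (arrows \<Gamma>)) L \<and>
     (\<exists>r. vector_subbundle \<Gamma> r Dc \<and>
        embedded_submanifold (arrows \<Gamma>) (dim (UNIV :: 'f set) + r) Mc)"

definition solves_DNEL ::
  "('g, 'e::real_inner, 'm, 'f::real_inner) groupoid \<Rightarrow>
     ('g \<Rightarrow> real) \<Rightarrow> 'g set \<Rightarrow> ('m \<Rightarrow> 'e set) \<Rightarrow> 'g \<Rightarrow> 'g \<Rightarrow> bool" where
  "solves_DNEL \<Gamma> L Mc Dc g h \<longleftrightarrow> (g, h) \<in> composable \<Gamma> \<inter> (Mc \<times> Mc) \<and>
     (\<forall>X\<in>Dc (tgt \<Gamma> g).
        differential (arrows \<Gamma>) (src_fibre \<Gamma> (tgt \<Gamma> g))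
          (\<lambda>k. (L \<circ> ltrans \<Gamma> g) k + (L \<circ> rtrans \<Gamma> h \<circ> inv_arr \<Gamma>) k) (ident \<Gamma> (tgt \<Gamma> g)) X = 0)"


section \<open>The cotangent groupoid\<close>

text \<open>
  Points of a bundle are pairs of a base point and a fibre element. A functional on a subspace
  is represented by means of \<^const>\<open>restrict\<close>, so that equality means equality on the subspace.
\<close>

definition cotangent_bundle :: "('a, 'e::real_inner) manifold \<Rightarrow> ('a \<times> ('e \<Rightarrow> real)) set" where
  "cotangent_bundle X = {(p, \<mu>). p \<in> pts X \<and> linear \<mu>}"

definition covector_d ::
  "('a, 'e::real_inner) manifold \<Rightarrow> ('a \<Rightarrow> real) \<Rightarrow> 'a \<Rightarrow> 'a \<times> ('e \<Rightarrow> real)" where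
  "covector_d X L g = (g, differential X (pts X) L g)"

definition cot_tgt :: "('g, 'e::real_inner, 'm, 'f::real_inner) groupoid \<Rightarrow>
    'g \<times> ('e \<Rightarrow> real) \<Rightarrow> 'm \<times> ('e \<Rightarrow> real)" where
  "cot_tgt \<Gamma> = (\<lambda>(g, \<mu>). (tgt \<Gamma> g, \<lambda>X\<in>algebroid_fibre \<Gamma> (tgt \<Gamma> g).
     \<mu> (tangent_map (arrows \<Gamma>) (arrows \<Gamma>) (src_fibre \<Gamma> (tgt \<Gamma> g))
          (ltrans \<Gamma> g) (ident \<Gamma> (tgt \<Gamma> g)) X)))"

definition cot_src :: "('g, 'e::real_inner, 'm, 'f::real_inner) groupoid \<Rightarrow>
    'g \<times> ('e \<Rightarrow> real) \<Rightarrow> 'm \<times> ('e \<Rightarrow> real)" where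
  "cot_src \<Gamma> = (\<lambda>(h, \<nu>). (src \<Gamma> h, \<lambda>Y\<in>algebroid_fibre \<Gamma> (src \<Gamma> h).
     \<nu> (tangent_map (arrows \<Gamma>) (arrows \<Gamma>) (tgt_fibre \<Gamma> (src \<Gamma> h))
          (rtrans \<Gamma> h) (ident \<Gamma> (src \<Gamma> h))
          (Y - tangent_map (arrows \<Gamma>) (arrows \<Gamma>) (pts (arrows \<Gamma>))
                 (ident \<Gamma> \<circ> tgt \<Gamma>) (ident \<Gamma> (src \<Gamma> h)) Y))))"

text \<open>The dual of the inclusion of a subbundle \<open>D\<close> into the Lie algebroid.\<close>

definition dual_incl :: "('m \<Rightarrow> 'e set) \<Rightarrow> 'm \<times> ('e \<Rightarrow> real) \<Rightarrow> 'm \<times> ('e \<Rightarrow> real)" where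
  "dual_incl D = (\<lambda>(x, \<xi>). (x, restrict \<xi> (D x)))"

definition cot_tgt_on where "cot_tgt_on \<Gamma> D = dual_incl D \<circ> cot_tgt \<Gamma>"

definition cot_src_on where "cot_src_on \<Gamma> D = dual_incl D \<circ> cot_src \<Gamma>"

text \<open>First step of the forward integrability algorithm; \<open>P\<close> is the domain of \<open>a\<close> and \<open>b\<close>.\<close>

definition forward_step :: "'p set \<Rightarrow> ('p \<Rightarrow> 'q) \<Rightarrow> ('p \<Rightarrow> 'q) \<Rightarrow> 'p set \<Rightarrow> 'p set" where
  "forward_step P a b S = S \<inter> {\<mu> \<in> P. b \<mu> \<in> a ` S}"

end

theory Submission
  imports Defs
begin

text \<open>
  Fix composable \<open>g, h \<in> Mc\<close>, put \<open>x = \<beta>(g) = \<alpha>(h)\<close>, and write \<open>\<epsilon>\<close> for the identity section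
  and \<open>i\<close> for the inversion. By the chain rule
  \<open>d(L \<circ> l\<^sub>g + L \<circ> r\<^sub>h \<circ> i)(X) = dL(g)(T l\<^sub>g X) + dL(h)(T r\<^sub>h (T i X))\<close> for \<open>X\<close> in the
  algebroid fibre over \<open>x\<close>. There \<open>T i X = T(\<epsilon> \<circ> \<beta>) X - X\<close>, so the right-hand side is exactly
  the difference of the values at \<open>X\<close> of the cotangent target of \<open>dL(g)\<close> and the cotangent source
  of \<open>dL(h)\<close>. Hence \<open>(g, h)\<close> solves the discrete equations if and only if these two
  functionals agree on the constraint subspace over \<open>x\<close>. The statements about the first step of
  the algorithm then follow by unfolding it: equality of two points of the dual bundle includes
  equality of their base points, that is, composability.

  The formula for \<open>T i\<close> comes from differentiating the identities \<open>k i(k) = \<epsilon>(x)\<close>,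
  \<open>k \<epsilon>(\<beta>(k)) = k\<close> and \<open>\<epsilon>(x) w = w\<close> along curves in the source fibre of \<open>x\<close>
  (lemma \<open>tangent_map_inv_on_algebroid\<close>).

  Curves are also what makes the derivatives meaningful. The translations are differentiated
  within source and target fibres, which need not be open, and a derivative within such a set is
  determined only on vectors that are tangent to it. Every vector of the algebroid fibre is
  the velocity of a curve in the source fibre (lemma \<open>algebroid_fibre_is_velocity\<close>), because the
  source map is a submersion; analytically this is the implicit function theorem, proved here
  with Banach's fixed point theorem (lemma \<open>kernel_vector_tangent_to_level_set\<close>). Along a curve
  defined on an open interval derivatives are unique, and so any two expressions for the same
  curve yield the same velocity.
\<close>

section \<open>Orthonormal bases of finite-dimensional inner product spaces\<close>

text \<open>
  The model spaces are inner product spaces that may be trivial, so orthonormal bases,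
  completeness and bounds for linear maps are derived from a finite spanning set.
\<close>

lemma orthonormal_basis_of_finite_span:
  fixes B :: "'f::real_inner set"
  assumes "finite B" "span B = UNIV"
  obtains C :: "'f set" where "finite C" "\<And>c. c \<in> C \<Longrightarrow> norm c = 1"
    "\<And>x. (\<Sum>c\<in>C. (x \<bullet> c) *\<^sub>R c) = x"
proof -
  obtain C0 where C0: "finite C0" "span C0 = span B" "pairwise orthogonal C0"
    using basis_orthogonal[OF assms(1)] by blast
  \<comment> \<open>An orthogonal spanning set may contain \<open>0\<close>, which cannot be normalised.\<close>
  define C where "C = (\<lambda>c. c /\<^sub>R norm c) ` (C0 - {0})"
  have fin: "finite C" using C0 by (simp add: C_def)
  have nrm: "norm c = 1" if "c \<in> C" for c using that by (auto simp: C_def field_simps split: if_splits)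
  have orth: "pairwise orthogonal C"
    using C0(3) unfolding C_def pairwise_def by (auto simp: orthogonal_def)
  have "C0 \<subseteq> span C"
  proof
    fix c assume c: "c \<in> C0"
    show "c \<in> span C"
    proof (cases "c = 0")
      case False
      then have "c /\<^sub>R norm c \<in> span C" using c by (auto simp: C_def intro!: span_base)
      then have "norm c *\<^sub>R (c /\<^sub>R norm c) \<in> span C" by (rule span_scale)
      then show ?thesis using False by simp
    qed (simp add: span_zero)
  qed
  then have "span C = UNIV" using C0(2) assms(2)
    by (metis span_minimal subspace_span top.extremum_uniqueI)
  then have "(\<Sum>c\<in>C. (x \<bullet> c) *\<^sub>R c) = x" for x
    using orthonormal_basis_expand[OF orth nrm _ fin] by auto
  then show ?thesis using that fin nrm by blast
qed

lemma complete_UNIV_of_finite_span: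
  fixes B :: "'f::real_inner set"
  assumes "finite B" "span B = UNIV"
  shows "complete (UNIV :: 'f set)"
proof (rule completeI)
  fix u :: "nat \<Rightarrow> 'f" assume u: "Cauchy u"
  obtain C :: "'f set" where C: "finite C" "\<And>c. c \<in> C \<Longrightarrow> norm c = 1"
    "\<And>x. (\<Sum>c\<in>C. (x \<bullet> c) *\<^sub>R c) = x"
    using orthonormal_basis_of_finite_span[OF assms] by blast
  have "convergent (\<lambda>n. u n \<bullet> c)" for c
    using bounded_linear.Cauchy[OF bounded_linear_inner_left u] by (simp add: Cauchy_convergent_iff)
  then have "(\<lambda>n. \<Sum>c\<in>C. (u n \<bullet> c) *\<^sub>R c) \<longlonglongrightarrow> (\<Sum>c\<in>C. lim (\<lambda>n. u n \<bullet> c) *\<^sub>R c)"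
    by (intro tendsto_intros) (simp add: convergent_LIMSEQ_iff)
  then show "\<exists>l\<in>UNIV. u \<longlonglongrightarrow> l" using C(3) by auto
qed

lemma linear_bound_on_orthonormal_basis:
  fixes T :: "'f::real_inner \<Rightarrow> 'b::real_normed_vector"
  assumes T: "linear T" and C: "finite C" "\<And>c. c \<in> C \<Longrightarrow> norm c = 1"
    "\<And>x. (\<Sum>c\<in>C. (x \<bullet> c) *\<^sub>R c) = x"
  shows "norm (T x) \<le> (\<Sum>c\<in>C. norm (T c)) * norm x"
proof -
  have "T x = (\<Sum>c\<in>C. (x \<bullet> c) *\<^sub>R T c)"
    by (subst C(3)[of x, symmetric]) (simp add: linear_sum[OF T] linear_scale[OF T])
  also have "norm \<dots> \<le> (\<Sum>c\<in>C. norm (T c) * norm x)"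
  proof (rule sum_norm_le)
    fix c assume "c \<in> C"
    then have "\<bar>x \<bullet> c\<bar> \<le> norm x" using Cauchy_Schwarz_ineq2[of x c] C(2) by simp
    then show "norm ((x \<bullet> c) *\<^sub>R T c) \<le> norm (T c) * norm x"
      by (simp add: mult.commute[of "norm (T c)"] mult_right_mono)
  qed
  finally show ?thesis by (simp add: sum_distrib_right)
qed

section \<open>Level sets of submersions\<close>

text \<open>
  The part of the implicit function theorem that is needed: with a right inverse \<open>R\<close> of the
  derivative at \<open>a\<close>, the line \<open>a + t v\<close> is corrected by \<open>R w\<close> to stay in the level set.
  Since \<open>v\<close> lies in the kernel, \<open>F(a + t v) - F(a)\<close> is \<open>o(t)\<close>, and the correction \<open>w\<close> is at most
  twice as large, so it does not change the velocity at \<open>0\<close>.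
\<close>

lemma kernel_vector_tangent_to_level_set:
  fixes F :: "'e::real_normed_vector \<Rightarrow> 'f::real_inner"
  assumes fin: "finite B0" "span B0 = (UNIV :: 'f set)"
    and F: "smooth_on U F" and a: "a \<in> U"
    and surj: "surj (frechet_derivative F (at a))"
    and v: "frechet_derivative F (at a) v = 0"
  obtains \<gamma> \<delta> where "\<delta> > 0" "\<gamma> 0 = a" "(\<gamma> has_derivative (\<lambda>t. t *\<^sub>R v)) (at (0::real))"
    "\<And>t. \<bar>t\<bar> < \<delta> \<Longrightarrow> \<gamma> t \<in> U \<and> F (\<gamma> t) = F a"
proof -
  let ?D = "\<lambda>y. frechet_derivative F (at y)"
  have oU: "open U" and C1: "Ck_on (Suc 0) U F" using F unfolding smooth_on_def by blast+
  have der: "(F has_derivative ?D y) (at y)" if "y \<in> U" for y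
    using C1 that by (auto simp: frechet_derivative_works)
  have lin: "linear (?D y)" if "y \<in> U" for y
    using der[OF that] has_derivative_linear by blast
  have cont: "continuous_on U (\<lambda>y. ?D y w)" for w using C1 by simp
  obtain C :: "'f set" where C: "finite C" "\<And>c. c \<in> C \<Longrightarrow> norm c = 1"
    "\<And>x. (\<Sum>c\<in>C. (x \<bullet> c) *\<^sub>R c) = x"
    using orthonormal_basis_of_finite_span[OF fin] by blast
  obtain R where R: "linear R" "?D a \<circ> R = id"
    using linear_surjective_right_inverse[OF lin[OF a] surj] by blast
  define K where "K = (\<Sum>c\<in>C. norm (R c))"
  have K0: "K \<ge> 0" unfolding K_def by (simp add: sum_nonneg)
  have K: "norm (R w) \<le> K * norm w" for w
    unfolding K_def by (rule linear_bound_on_orthonormal_basis[OF R(1) C])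
  have blR: "bounded_linear R"
    using R(1) K by (simp add: bounded_linear_def bounded_linear_axioms_def mult.commute) (metis mult.commute)
  \<comment> \<open>Near \<open>a\<close> the operator \<open>I - DF R\<close> is small, since it vanishes at \<open>a\<close>.\<close>
  have "\<forall>\<^sub>F y in nhds a. (\<Sum>c\<in>C. norm (c - ?D y (R c))) < 1/2"
  proof -
    have "isCont (\<lambda>y. ?D y (R c)) a" for c
      using cont oU a by (simp add: continuous_on_eq_continuous_at)
    then have "isCont (\<lambda>y. \<Sum>c\<in>C. norm (c - ?D y (R c))) a" (is "isCont ?g a")
      by (intro continuous_intros)
    then have "(?g \<longlongrightarrow> ?g a) (nhds a)"
      unfolding isCont_def by (rule iffD1[OF tendsto_at_iff_tendsto_nhds])
    moreover have "?g a = 0"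
      using R(2) by (simp add: fun_eq_iff)
    ultimately have "(?g \<longlongrightarrow> 0) (nhds a)" by (simp only:)
    then show ?thesis by (rule order_tendstoD(2)) simp
  qed
  then have "\<forall>\<^sub>F y in nhds a. y \<in> U \<and> (\<Sum>c\<in>C. norm (c - ?D y (R c))) < 1/2"
    using eventually_nhds_in_open[OF oU a] by eventually_elim auto
  then obtain \<rho> where \<rho>: "\<rho> > 0"
    "\<And>y. dist y a < \<rho> \<Longrightarrow> y \<in> U \<and> (\<Sum>c\<in>C. norm (c - ?D y (R c))) < 1/2"
    unfolding eventually_nhds_metric by blast
  \<comment> \<open>The correction \<open>R w\<close> uses up at most half of the radius \<open>\<rho>\<close>, the step \<open>t v\<close> the other half.\<close>
  define r where "r = \<rho> / (2 * (K + 1))"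
  have r: "r > 0" "K * r < \<rho> / 2"
    using \<rho> K0 by (auto simp: r_def field_simps add_pos_nonneg)
  define f where "f t = F (a + t *\<^sub>R v)" for t :: real
  have f: "(f has_derivative (\<lambda>t. 0)) (at 0)"
  proof -
    have "((\<lambda>t::real. a + t *\<^sub>R v) has_derivative (\<lambda>t. t *\<^sub>R v)) (at 0)"
      by (auto intro!: derivative_eq_intros)
    then have "(f has_derivative (\<lambda>t. ?D a (t *\<^sub>R v))) (at 0)"
      unfolding f_def by (rule has_derivative_compose) (use der[OF a] in simp)
    then show ?thesis using v lin[OF a] by (simp add: linear_scale)
  qed
  then have "isCont f 0" by (rule has_derivative_continuous)
  then have "\<forall>\<^sub>F t in nhds 0. dist (f t) (f 0) < r / 2"
    using r(1) by (metis half_gt_zero isCont_def tendstoD tendsto_at_iff_tendsto_nhds)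
  moreover have "\<forall>\<^sub>F t in nhds 0. norm (t *\<^sub>R v) < \<rho> / 2"
  proof -
    have "((\<lambda>t. norm (t *\<^sub>R v)) \<longlongrightarrow> norm (0 *\<^sub>R v)) (nhds 0)" 
      by (intro tendsto_intros filterlim_ident)
    then show ?thesis using \<rho>(1) by (auto dest!: order_tendstoD(2)[where a = "\<rho>/2"])
  qed
  ultimately have "\<forall>\<^sub>F t in nhds 0. dist (f t) (f 0) < r / 2 \<and> norm (t *\<^sub>R v) < \<rho> / 2"
    by eventually_elim auto
  then obtain \<delta> where \<delta>: "\<delta> > 0" 
    "\<And>t. \<bar>t\<bar> < \<delta> \<Longrightarrow> norm (f t - f 0) < r / 2 \<and> norm (t *\<^sub>R v) < \<rho> / 2"
    unfolding eventually_nhds_metric by (auto simp: dist_norm)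
  have ex: "\<exists>w. norm w \<le> r \<and> norm w \<le> 2 * norm (f t - f 0) \<and> F (a + t *\<^sub>R v + R w) = F a"
    if t: "\<bar>t\<bar> < \<delta>" for t
  proof -
    \<comment> \<open>Newton's iteration for \<open>F(a + t v + R w) = F(a)\<close> in \<open>w\<close>, with the derivative at \<open>a\<close> used throughout.\<close>
    define H where "H w = w - (F (a + t *\<^sub>R v + R w) - F a)" for w
    have near: "a + t *\<^sub>R v + R w \<in> U \<and> (\<Sum>c\<in>C. norm (c - ?D (a + t *\<^sub>R v + R w) (R c))) < 1/2"
      if "w \<in> cball 0 r" for w
    proof (rule \<rho>(2))
      have "norm (R w) \<le> K * r" using K[of w] mult_left_mono[OF _ K0, of "norm w" r] that by simp
      then show "dist (a + t *\<^sub>R v + R w) a < \<rho>"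
        using \<delta>(2)[OF t] r(2) norm_triangle_ineq[of "t *\<^sub>R v" "R w"] by (simp add: dist_norm add.assoc)
    qed
    have H: "norm (H w - H w') \<le> 1/2 * norm (w - w')" if "w \<in> cball 0 r" "w' \<in> cball 0 r" for w w'
    proof (rule differentiable_bound[OF convex_cball _ _ that])
      fix u :: 'f assume u: "u \<in> cball 0 r"
      let ?y = "a + t *\<^sub>R v + R u"
      have "((\<lambda>w. a + t *\<^sub>R v + R w) has_derivative R) (at u within cball 0 r)"
        using bounded_linear_imp_has_derivative[OF blR] by (auto intro!: derivative_eq_intros)
      from has_derivative_compose[OF this der]
      have "((\<lambda>w. F (a + t *\<^sub>R v + R w)) has_derivative (\<lambda>w. ?D ?y (R w))) (at u within cball 0 r)"
        using near[OF u] by simp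
      then show "(H has_derivative (\<lambda>w. w - ?D ?y (R w))) (at u within cball 0 r)"
        unfolding H_def by (auto intro!: derivative_eq_intros)
      have ln: "linear (\<lambda>w. w - ?D ?y (R w))"
        using linear_compose_sub[OF linear_ident linear_compose[OF R(1) lin[of ?y]]] near[OF u]
        by (simp add: o_def)
      show "onorm (\<lambda>w. w - ?D ?y (R w)) \<le> 1/2"
      proof (rule onorm_bound)
        fix w
        have "norm (w - ?D ?y (R w)) \<le> (\<Sum>c\<in>C. norm (c - ?D ?y (R c))) * norm w"
          using linear_bound_on_orthonormal_basis[OF ln C] .
        also have "\<dots> \<le> 1/2 * norm w" using near[OF u] by (intro mult_right_mono) auto
        finally show "norm (w - ?D ?y (R w)) \<le> 1/2 * norm w" .
      qed simp
    qed
    have f0: "f 0 = F a" by (simp add: f_def)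
    have "linear R" by fact
    then have H0: "H 0 = - (f t - f 0)" by (simp add: H_def f_def linear_0)
    have bd: "norm (H w) \<le> norm (f t - f 0) + 1/2 * norm w" if "w \<in> cball 0 r" for w
    proof -
      have "norm (H w) \<le> norm (H 0) + norm (H w - H 0)"
        using norm_triangle_ineq[of "H 0" "H w - H 0"] by simp
      then show ?thesis using H[OF that, of 0] r(1) H0 by (simp add: norm_minus_commute[of "f t"])
    qed
    have "\<exists>!w\<in>cball 0 r. H w = w"
    proof (rule Banach_fix)
      show "complete (cball 0 r :: 'f set)"
        by (rule complete_closed_subset[OF _ subset_UNIV complete_UNIV_of_finite_span[OF fin]]) simp
      show "H ` cball 0 r \<subseteq> cball 0 r"
        using bd \<delta>(2)[OF t] by fastforce
      show "dist (H w) (H w') \<le> 1/2 * dist w w'" if "w \<in> cball 0 r" "w' \<in> cball 0 r" for w w'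
        using H that by (simp add: dist_norm)
    qed (use r(1) in auto)
    then obtain w where w: "w \<in> cball 0 r" "H w = w" by blast
    then have "norm w \<le> 2 * norm (f t - f 0)" using bd[OF w(1)] by simp
    moreover have "F (a + t *\<^sub>R v + R w) = F a" using w(2) by (simp add: H_def)
    ultimately show ?thesis using w(1) by auto
  qed
  then obtain w where w: "\<And>t. \<bar>t\<bar> < \<delta> \<Longrightarrow>
      norm (w t) \<le> r \<and> norm (w t) \<le> 2 * norm (f t - f 0) \<and> F (a + t *\<^sub>R v + R (w t)) = F a"
    by metis
  have w0: "w 0 = 0" using w[of 0] \<delta>(1) by simp
  have "(w has_derivative (\<lambda>t. 0)) (at 0)"
  proof (rule has_derivativeI_sandwich[OF \<delta>(1)])
    show "norm (w t - w 0 - 0) / norm (t - 0) \<le> 2 * (norm (f t - f 0 - 0) / norm (t - 0))"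
      if "dist t 0 < \<delta>" for t
      using w[of t] that w0 by (simp add: divide_right_mono)
    show "((\<lambda>t. 2 * (norm (f t - f 0 - 0) / norm (t - 0))) \<longlongrightarrow> 0) (at 0)"
      using f unfolding has_derivative_iff_norm by (intro tendsto_mult_right_zero) auto
  qed simp
  then have "((\<lambda>t. R (w t)) has_derivative (\<lambda>t. R 0)) (at 0)"
    by (rule bounded_linear.has_derivative[OF blR])
  then have "((\<lambda>t. a + t *\<^sub>R v + R (w t)) has_derivative (\<lambda>t. t *\<^sub>R v)) (at 0)"
    using linear_0[OF R(1)] by (auto intro!: derivative_eq_intros)
  moreover have "a + t *\<^sub>R v + R (w t) \<in> U" if t: "\<bar>t\<bar> < \<delta>" for t
  proof -
    have "norm (R (w t)) \<le> K * r" using K[of "w t"] mult_left_mono[OF _ K0, of "norm (w t)" r] w[OF t] by simp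
    then show ?thesis
      using \<delta>(2)[OF t] r(2) norm_triangle_ineq[of "t *\<^sub>R v" "R (w t)"]
        \<rho>(2)[of "a + t *\<^sub>R v + R (w t)"] by (simp add: dist_norm add.assoc)
  qed
  ultimately show ?thesis
    using that[of \<delta> "\<lambda>t. a + t *\<^sub>R v + R (w t)"] \<delta>(1) w w0 linear_0[OF R(1)] by auto
qed

section \<open>Derivatives in charts\<close>

text \<open>
  The derivative of \<open>f\<close> at \<open>p\<close> within \<open>S\<close>, expressed in charts \<open>c\<close> and \<open>d\<close>. The neighbourhood
  \<open>U\<close> is needed because the coordinate map of \<open>d\<close> is arbitrary outside its domain: the
  coordinate expression of \<open>f\<close> is meaningful only where \<open>f\<close> takes values in that domain. Curves
  are included as maps on a set of reals with the chart \<open>(UNIV, id)\<close>, and so one chain rule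
  covers maps between manifolds, velocities of curves and real-valued functions.
\<close>

definition chart_has_derivative :: "('a, 'e::real_normed_vector) chart \<Rightarrow> ('b, 'f::real_normed_vector) chart \<Rightarrow>
    'a set \<Rightarrow> ('a \<Rightarrow> 'b) \<Rightarrow> 'a \<Rightarrow> ('e \<Rightarrow> 'f) \<Rightarrow> bool" where
  "chart_has_derivative c d S f p D \<longleftrightarrow>
     p \<in> S \<inter> fst c \<and> inj_on (snd c) (fst c) \<and>
     (\<exists>U. open U \<and> snd c p \<in> U \<and> (\<forall>q\<in>fst c \<inter> S. snd c q \<in> U \<longrightarrow> f q \<in> fst d)) \<and>
     (in_charts c d f has_derivative D) (at (snd c p) within snd c ` (fst c \<inter> S))"

lemma chart_has_derivativeD:
  "chart_has_derivative c d S f p D \<Longrightarrow>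
    (in_charts c d f has_derivative D) (at (snd c p) within snd c ` (fst c \<inter> S))"
  unfolding chart_has_derivative_def by (elim conjE)

lemma chart_has_derivative_linear:
  "chart_has_derivative c d S f p D \<Longrightarrow> linear D"
  unfolding chart_has_derivative_def using has_derivative_linear by blast

lemma chart_has_derivative_cong:
  assumes "chart_has_derivative c d S f p D" "\<And>q. q \<in> S \<Longrightarrow> f' q = f q"
  shows "chart_has_derivative c d S f' p D"
proof -
  have "(in_charts c d f' has_derivative D) (at (snd c p) within snd c ` (fst c \<inter> S))"
    by (rule has_derivative_transform[where f = "in_charts c d f"])
      (use assms in \<open>auto simp: chart_has_derivative_def in_charts_def\<close>)
  then show ?thesis using assms unfolding chart_has_derivative_def by auto
qed

lemma chart_has_derivative_subset:
  assumes "chart_has_derivative c d S f p D" "T \<subseteq> S" "p \<in> T"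
  shows "chart_has_derivative c d T f p D"
proof -
  have "snd c ` (fst c \<inter> T) \<subseteq> snd c ` (fst c \<inter> S)" using assms(2) by blast
  from has_derivative_subset[OF chart_has_derivativeD[OF assms(1)] this]
  show ?thesis using assms unfolding chart_has_derivative_def by blast
qed

lemma chart_has_derivative_compose:
  assumes f: "chart_has_derivative c d S f p D" and g: "chart_has_derivative d e S' g (f p) D'"
    and sub: "\<And>q. q \<in> S \<Longrightarrow> f q \<in> S'"
  shows "chart_has_derivative c e S (\<lambda>q. g (f q)) p (\<lambda>v. D' (D v))"
proof -
  let ?A = "snd c ` (fst c \<inter> S)" and ?B = "snd d ` (fst d \<inter> S')" and ?a = "snd c p"
  let ?F = "in_charts c d f"
  have p: "p \<in> S" "p \<in> fst c" and ic: "inj_on (snd c) (fst c)" and id: "inj_on (snd d) (fst d)"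
    and derF: "(?F has_derivative D) (at ?a within ?A)"
    and derG: "(in_charts d e g has_derivative D') (at (snd d (f p)) within ?B)"
    using f g unfolding chart_has_derivative_def by auto
  obtain U where U: "open U" "?a \<in> U" "\<And>q. q \<in> fst c \<inter> S \<Longrightarrow> snd c q \<in> U \<Longrightarrow> f q \<in> fst d"
    using f unfolding chart_has_derivative_def by metis
  obtain U' where U': "open U'" "snd d (f p) \<in> U'"
    "\<And>q. q \<in> fst d \<inter> S' \<Longrightarrow> snd d q \<in> U' \<Longrightarrow> g q \<in> fst e"
    using g unfolding chart_has_derivative_def by metis
  have F: "?F (snd c q) = snd d (f q)" if "q \<in> fst c" for q
    using that ic by (simp add: in_charts_def)
  have "continuous (at ?a within ?A) ?F" using derF by (rule has_derivative_continuous)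
  then obtain V where V: "open V" "?a \<in> V" "\<And>y. y \<in> ?A \<Longrightarrow> y \<in> V \<Longrightarrow> ?F y \<in> U'"
    using U' F[OF p(2)] unfolding continuous_within_topological by metis
  let ?W = "U \<inter> V" and ?A' = "snd c ` (fst c \<inter> S) \<inter> (U \<inter> V)"
  have W: "open ?W" "?a \<in> ?W" using U V by auto
  have at: "at ?a within ?A = at ?a within ?A'"
    by (rule at_within_nhd[OF W(2,1)]) auto
  have "?F ` ?A' \<subseteq> ?B"
    using F U(3) sub by auto
  then have derG': "(in_charts d e g has_derivative D') (at (?F ?a) within ?F ` ?A')"
    using derG F[OF p(2)] by (auto intro: has_derivative_subset)
  have "((\<lambda>y. in_charts d e g (?F y)) has_derivative (\<lambda>v. D' (D v))) (at ?a within ?A')"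
    by (rule has_derivative_in_compose[OF _ derG']) (use derF at in simp)
  then have "(in_charts c e (\<lambda>q. g (f q)) has_derivative (\<lambda>v. D' (D v))) (at ?a within ?A')"
  proof (rule has_derivative_transform[rotated 2])
    show "?a \<in> ?A'" using p W by auto
    fix y assume "y \<in> ?A'"
    then obtain q where q: "y = snd c q" "q \<in> fst c" "q \<in> S" "y \<in> U" by auto
    then have "f q \<in> fst d" using U(3) by auto
    then show "in_charts c e (\<lambda>q. g (f q)) y = in_charts d e g (?F y)"
      using q ic id by (simp add: in_charts_def)
  qed
  moreover have "g (f q) \<in> fst e" if "q \<in> fst c \<inter> S" "snd c q \<in> ?W" for q
    using that U(3) U'(3) V(3) F sub by (metis IntD1 IntD2 IntI imageI)
  ultimately show ?thesis
    using p ic W at unfolding chart_has_derivative_def by auto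
qed

lemma chart_has_derivative_ident:
  assumes "p \<in> S" "p \<in> fst c" "inj_on (snd c) (fst c)"
  shows "chart_has_derivative c c S (\<lambda>q. q) p (\<lambda>v. v)"
proof -
  have "(in_charts c c (\<lambda>q. q) has_derivative (\<lambda>v. v)) (at (snd c p) within snd c ` (fst c \<inter> S))"
    by (rule has_derivative_transform[OF _ _ has_derivative_ident])
      (use assms in \<open>auto simp: in_charts_def f_inv_into_f\<close>)
  then show ?thesis using assms unfolding chart_has_derivative_def by auto
qed

lemma chart_has_derivative_const:
  assumes "p \<in> S" "p \<in> fst c" "inj_on (snd c) (fst c)" "b \<in> fst d"
  shows "chart_has_derivative c d S (\<lambda>q. b) p (\<lambda>v. 0)"
  using assms unfolding chart_has_derivative_def in_charts_def o_def by auto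

definition prod_chart :: "('a, 'e) chart \<Rightarrow> ('b, 'f) chart \<Rightarrow> ('a \<times> 'b, 'e \<times> 'f) chart" where
  "prod_chart c d = (fst c \<times> fst d, map_prod (snd c) (snd d))"

lemma chart_has_derivative_Pair:
  assumes f: "chart_has_derivative c d S f p D" and g: "chart_has_derivative c d' S g p D'"
  shows "chart_has_derivative c (prod_chart d d') S (\<lambda>q. (f q, g q)) p (\<lambda>v. (D v, D' v))"
proof -
  obtain U where U: "open U" "snd c p \<in> U" "\<And>q. q \<in> fst c \<inter> S \<Longrightarrow> snd c q \<in> U \<Longrightarrow> f q \<in> fst d"
    using f unfolding chart_has_derivative_def by metis
  obtain U' where U': "open U'" "snd c p \<in> U'" "\<And>q. q \<in> fst c \<inter> S \<Longrightarrow> snd c q \<in> U' \<Longrightarrow> g q \<in> fst d'"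
    using g unfolding chart_has_derivative_def by metis
  have "in_charts c (prod_chart d d') (\<lambda>q. (f q, g q)) = (\<lambda>y. (in_charts c d f y, in_charts c d' g y))"
    by (auto simp: in_charts_def prod_chart_def)
  moreover have "((\<lambda>y. (in_charts c d f y, in_charts c d' g y)) has_derivative (\<lambda>v. (D v, D' v)))
      (at (snd c p) within snd c ` (fst c \<inter> S))"
    by (rule has_derivative_Pair) (use f g in \<open>simp_all add: chart_has_derivative_def\<close>)
  moreover have "\<exists>U. open U \<and> snd c p \<in> U \<and>
      (\<forall>q\<in>fst c \<inter> S. snd c q \<in> U \<longrightarrow> (f q, g q) \<in> fst (prod_chart d d'))"
    using U U' by (intro exI[of _ "U \<inter> U'"]) (auto simp: prod_chart_def)
  ultimately show ?thesis
    using f unfolding chart_has_derivative_def by simp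
qed

lemma chart_has_derivative_add:
  fixes f g :: "'a \<Rightarrow> real"
  assumes f: "chart_has_derivative c (UNIV, id) S f p D" and g: "chart_has_derivative c (UNIV, id) S g p D'"
  shows "chart_has_derivative c (UNIV, id) S (\<lambda>q. f q + g q) p (\<lambda>v. D v + D' v)"
proof -
  have "in_charts c (UNIV, id) (\<lambda>q. f q + g q) = (\<lambda>y. in_charts c (UNIV, id) f y + in_charts c (UNIV, id) g y)"
    by (auto simp: in_charts_def)
  moreover have "((\<lambda>y. in_charts c (UNIV, id) f y + in_charts c (UNIV, id) g y) has_derivative
      (\<lambda>v. D v + D' v)) (at (snd c p) within snd c ` (fst c \<inter> S))"
    by (rule has_derivative_add) (use f g in \<open>simp_all add: chart_has_derivative_def\<close>)
  ultimately show ?thesis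
    using f unfolding chart_has_derivative_def by auto
qed

text \<open>
  Within an arbitrary set the derivative need not be unique; within an open set of reals it is.
  All identities between tangent maps are reduced to this case.
\<close>

lemma chart_has_derivative_unique_open:
  assumes "chart_has_derivative (UNIV, id) d T \<gamma> p D" "chart_has_derivative (UNIV, id) d T \<gamma> p D'" "open T"
  shows "D = D'"
proof -
  have p: "p \<in> T" using assms(1) unfolding chart_has_derivative_def by simp
  have "(in_charts (UNIV, id) d \<gamma> has_derivative E) (at p)"
    if "chart_has_derivative (UNIV, id) d T \<gamma> p E" for E
    using chart_has_derivativeD[OF that] at_within_open[OF p assms(3)] by simp
  from this[OF assms(1)] this[OF assms(2)] show ?thesis by (rule has_derivative_unique)
qed

section \<open>Smooth maps and tangent maps\<close>

lemma chart_at_in_atlas: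
  assumes "smooth_manifold X" "p \<in> pts X"
  shows "chart_at X p \<in> atlas X" "p \<in> fst (chart_at X p)" "inj_on (snd (chart_at X p)) (fst (chart_at X p))"
proof -
  have "\<exists>c. c \<in> atlas X \<and> p \<in> fst c" using assms unfolding smooth_manifold_def by blast
  then show *: "chart_at X p \<in> atlas X" "p \<in> fst (chart_at X p)"
    unfolding chart_at_def by (metis (mono_tags, lifting) someI_ex)+
  then have tc: "topological_chart X (chart_at X p)" using assms unfolding smooth_manifold_def by blast
  then show "inj_on (snd (chart_at X p)) (fst (chart_at X p))"
    using homeomorphic_imp_injective_map[of "subtopology (mtop X) (fst (chart_at X p))"]
    unfolding topological_chart_def by (auto simp: openin_subset Int_absorb1 topspace_subtopology)
qed

text \<open>
  A smooth map on a subset is locally the restriction of a smooth map on an open set, and the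
  derivative of such an extension is a derivative within the subset. The charts are arbitrary
  atlas charts, because on a product manifold the charts chosen for the two factors need not
  form the chart chosen for the pair.
\<close>

lemma smooth_map_imp_chart_has_derivative:
  assumes f: "smooth_map X Y S f" and p: "p \<in> S" and c: "c \<in> atlas X" "p \<in> fst c" "inj_on (snd c) (fst c)"
    and d: "d \<in> atlas Y" "f p \<in> fst d"
  shows "\<exists>D. chart_has_derivative c d S f p D"
proof -
  obtain W F where W: "p \<in> W" "smooth_map_open X Y W F" "\<And>q. q \<in> S \<inter> W \<Longrightarrow> F q = f q"
    using f p unfolding smooth_map_def by metis
  let ?V = "snd c ` (fst c \<inter> W \<inter> F -` fst d)"
  have "smooth_on ?V (in_charts c d F)" using W(2) c(1) d(1) unfolding smooth_map_open_def by blast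
  then have V: "open ?V" and Ck: "Ck_on (Suc 0) ?V (in_charts c d F)" unfolding smooth_on_def by blast+
  have pV: "snd c p \<in> ?V" using W p c d by auto
  have "in_charts c d F differentiable (at (snd c p))" using Ck pV unfolding Ck_on.simps by blast
  then obtain D where D: "(in_charts c d F has_derivative D) (at (snd c p))"
    unfolding differentiable_def by blast
  have V_D: "q \<in> W \<and> F q \<in> fst d" if "q \<in> fst c" "snd c q \<in> ?V" for q
    using that c(3) by (auto dest: inj_onD)
  let ?A = "snd c ` (fst c \<inter> S)"
  have at: "at (snd c p) within ?A = at (snd c p) within ?A \<inter> ?V"
    by (rule at_within_nhd[OF pV V]) auto
  have "(in_charts c d f has_derivative D) (at (snd c p) within ?A \<inter> ?V)"
  proof (rule has_derivative_transform)
    show "snd c p \<in> ?A \<inter> ?V" using pV p c by auto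
    show "(in_charts c d F has_derivative D) (at (snd c p) within ?A \<inter> ?V)"
      using D by (rule has_derivative_at_withinI)
    fix y assume "y \<in> ?A \<inter> ?V"
    then obtain q where q: "y = snd c q" "q \<in> fst c" "q \<in> S" "snd c q \<in> ?V" by blast
    have "F q = f q" using V_D[OF q(2,4)] W(3) q(3) by blast
    then show "in_charts c d f y = in_charts c d F y"
      using q(1,2) c(3) by (simp add: in_charts_def)
  qed
  then have "(in_charts c d f has_derivative D) (at (snd c p) within ?A)" unfolding at .
  moreover have "f q \<in> fst d" if "q \<in> fst c \<inter> S" "snd c q \<in> ?V" for q
    using V_D[of q] W(3)[of q] that by (metis IntD1 IntD2 IntI)
  then have "\<exists>U. open U \<and> snd c p \<in> U \<and> (\<forall>q\<in>fst c \<inter> S. snd c q \<in> U \<longrightarrow> f q \<in> fst d)"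
    using V pV by blast
  ultimately show ?thesis
    using p c(2,3) unfolding chart_has_derivative_def by blast
qed

text \<open>The tangent map is a choice among the derivatives within \<open>S\<close>, so it is one as soon as there is one.\<close>

lemma tangent_mapI:
  assumes "chart_has_derivative (chart_at X p) (chart_at Y (f p)) S f p D"
  shows "chart_has_derivative (chart_at X p) (chart_at Y (f p)) S f p (tangent_map X Y S f p)"
proof -
  have "in_charts (chart_at X p) (chart_at Y (f p)) f differentiable
      (at (snd (chart_at X p) p) within snd (chart_at X p) ` (fst (chart_at X p) \<inter> S))"
    using chart_has_derivativeD[OF assms] unfolding differentiable_def by blast
  then show ?thesis
    using assms unfolding frechet_derivative_works chart_has_derivative_def tangent_map_def Let_def
    by blast
qed

lemma smooth_map_tangent_map:
  assumes "smooth_manifold X" "smooth_manifold Y" "smooth_map X Y S f" "p \<in> S" "f p \<in> pts Y"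
  shows "chart_has_derivative (chart_at X p) (chart_at Y (f p)) S f p (tangent_map X Y S f p)"
proof -
  have "p \<in> pts X" using assms(3,4) by (auto simp: smooth_map_def)
  then show ?thesis
    using smooth_map_imp_chart_has_derivative[OF assms(3,4)] chart_at_in_atlas assms(1,2,5) tangent_mapI
    by metis
qed

lemma chart_at_vector_manifold: "chart_at vector_manifold y = (UNIV, id)"
  unfolding chart_at_def vector_manifold_def by (rule some_equality) auto

lemma smooth_map_differential:
  assumes "smooth_manifold X" "smooth_map X vector_manifold S f" "p \<in> S"
  shows "chart_has_derivative (chart_at X p) (UNIV, id) S f p (differential X S f p)"
proof -
  have "p \<in> pts X" using assms(2,3) by (auto simp: smooth_map_def)
  then have "\<exists>D. chart_has_derivative (chart_at X p) (UNIV, id) S f p D"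
    by (intro smooth_map_imp_chart_has_derivative[OF assms(2,3)])
      (auto simp: chart_at_in_atlas[OF assms(1)] vector_manifold_def)
  then show ?thesis using tangent_mapI[of X p vector_manifold f] by (auto simp: chart_at_vector_manifold)
qed

text \<open>
  The lemma on level sets in coordinates is applied to a smooth extension \<open>F\<close> of \<open>f\<close> near \<open>p\<close> in the
  two chosen charts; the resulting curve is then pulled back to the manifold.
\<close>

lemma submersion_kernel_is_velocity:
  assumes X: "smooth_manifold X" and Y: "smooth_manifold Y" and f: "submersion X Y f"
    and p: "p \<in> pts X" and fp: "f p \<in> pts Y" and v: "tangent_map X Y (pts X) f p v = 0"
  obtains \<gamma> T where "open T" "\<gamma> 0 = p" "\<And>t. t \<in> T \<Longrightarrow> \<gamma> t \<in> pts X \<and> f (\<gamma> t) = f p"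
    "chart_has_derivative (UNIV, id) (chart_at X p) T \<gamma> (0::real) (\<lambda>t. t *\<^sub>R v)"
proof -
  let ?c = "chart_at X p" and ?d = "chart_at Y (f p)"
  note c = chart_at_in_atlas[OF X p] and d = chart_at_in_atlas[OF Y fp]
  have tc: "openin (mtop X) (fst ?c)" "open (snd ?c ` fst ?c)"
    using X c unfolding smooth_manifold_def topological_chart_def by blast+
  have sub: "fst ?c \<subseteq> pts X" using tc(1) by (rule openin_subset)
  then have fc: "fst ?c \<inter> pts X = fst ?c" by blast
  obtain W F where W: "p \<in> W" "smooth_map_open X Y W F" "\<And>q. q \<in> pts X \<inter> W \<Longrightarrow> F q = f q"
    using f p unfolding submersion_def smooth_map_def by metis
  let ?V = "snd ?c ` (fst ?c \<inter> W \<inter> F -` fst ?d)" and ?G = "in_charts ?c ?d F" and ?a = "snd ?c p"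
  have G: "smooth_on ?V ?G" using W(2) c(1) d(1) unfolding smooth_map_open_def by blast
  have aV: "?a \<in> ?V" using W p c d by auto
  have oV: "open ?V" using G unfolding smooth_on_def by blast
  have V: "q \<in> W \<and> F q \<in> fst ?d" if "q \<in> fst ?c" "snd ?c q \<in> ?V" for q
    using that c(3) by (auto dest: inj_onD)
  have tan: "chart_has_derivative ?c ?d (pts X) f p (tangent_map X Y (pts X) f p)"
    by (rule smooth_map_tangent_map[where S = "pts X"]) (use f p X Y fp in \<open>auto simp: submersion_def\<close>)
  have "at ?a within snd ?c ` fst ?c = at ?a"
    using c(2) tc(2) by (intro at_within_open) auto
  then have "(in_charts ?c ?d f has_derivative tangent_map X Y (pts X) f p) (at ?a)"
    using chart_has_derivativeD[OF tan] unfolding fc by simp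
  then have "(?G has_derivative tangent_map X Y (pts X) f p) (at ?a)"
  proof (rule has_derivative_transform_within_open[OF _ oV aV])
    fix y assume "y \<in> ?V"
    then obtain q where q: "y = snd ?c q" "q \<in> fst ?c" "q \<in> W" by blast
    then have "F q = f q" using W(3) sub by blast
    then show "in_charts ?c ?d f y = ?G y" using q(1,2) c(3) by (simp add: in_charts_def)
  qed
  then have fd: "frechet_derivative ?G (at ?a) = tangent_map X Y (pts X) f p"
    by (rule frechet_derivative_at[symmetric])
  obtain B :: "'d set" where B: "finite B" "span B = UNIV"
    using Y unfolding smooth_manifold_def by blast
  obtain \<gamma> \<delta> where \<gamma>: "\<delta> > 0" "\<gamma> 0 = ?a" "(\<gamma> has_derivative (\<lambda>t. t *\<^sub>R v)) (at (0::real))"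
    "\<And>t. \<bar>t\<bar> < \<delta> \<Longrightarrow> \<gamma> t \<in> ?V \<and> ?G (\<gamma> t) = ?G ?a"
    using kernel_vector_tangent_to_level_set[OF B G aV, of v] f p v unfolding fd submersion_def by metis
  define k where "k t = inv_into (fst ?c) (snd ?c) (\<gamma> t)" for t
  have k: "k t \<in> fst ?c" "snd ?c (k t) = \<gamma> t" "f (k t) = f p" if "\<bar>t\<bar> < \<delta>" for t
  proof -
    have t: "\<gamma> t \<in> ?V" "?G (\<gamma> t) = ?G ?a" using \<gamma>(4)[OF that] by auto
    then have "\<gamma> t \<in> snd ?c ` fst ?c" by blast
    then show 1: "k t \<in> fst ?c" "snd ?c (k t) = \<gamma> t"
      unfolding k_def by (rule inv_into_into, rule f_inv_into_f)
    then have 2: "k t \<in> W" "F (k t) \<in> fst ?d" using V t by metis+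
    then have "snd ?d (F (k t)) = snd ?d (F p)"
      using t(2) c(2,3) by (simp add: in_charts_def flip: k_def)
    moreover have "F p = f p" "F (k t) = f (k t)" using W(1,3) p 1(1) 2(1) sub by blast+
    ultimately show "f (k t) = f p" using d(2,3) 2(2) by (metis inj_onD)
  qed
  have "chart_has_derivative (UNIV, id) ?c {- \<delta><..<\<delta>} k 0 (\<lambda>t. t *\<^sub>R v)"
  proof -
    have "(in_charts (UNIV, id) ?c k has_derivative (\<lambda>t. t *\<^sub>R v)) (at 0 within {- \<delta><..<\<delta>})"
      by (rule has_derivative_transform[OF _ _ has_derivative_at_withinI[OF \<gamma>(3)]])
        (use \<gamma>(1) k(2) in \<open>auto simp: in_charts_def\<close>)
    moreover have "\<exists>U. open U \<and> (0::real) \<in> U \<and> (\<forall>t\<in>{- \<delta><..<\<delta>}. t \<in> U \<longrightarrow> k t \<in> fst ?c)"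
      using k(1) by (intro exI[of _ UNIV]) auto
    ultimately show ?thesis using \<gamma>(1) unfolding chart_has_derivative_def by simp
  qed
  moreover have "k 0 = p" using \<gamma>(2) c(2,3) by (simp add: k_def)
  ultimately show ?thesis
    using k sub \<gamma>(1) by (intro that[of "{- \<delta><..<\<delta>}" k]) (auto simp: abs_less_iff)
qed

section \<open>Velocities of curves\<close>

definition has_velocity :: "('a, 'e::real_inner) manifold \<Rightarrow> real set \<Rightarrow> (real \<Rightarrow> 'a) \<Rightarrow> 'e \<Rightarrow> bool" where
  "has_velocity X T \<gamma> v \<longleftrightarrow>
     chart_has_derivative (UNIV, id) (chart_at X (\<gamma> 0)) T \<gamma> 0 (\<lambda>t. t *\<^sub>R v)"

lemma has_velocity_unique:
  assumes "has_velocity X T \<gamma> v" "has_velocity X T \<gamma> w" "open T"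
  shows "v = w"
proof -
  have "(\<lambda>t. t *\<^sub>R v) = (\<lambda>t::real. t *\<^sub>R w)"
    using assms chart_has_derivative_unique_open unfolding has_velocity_def by blast
  then show ?thesis by (metis scaleR_one)
qed

lemma has_velocity_zero_in_domain: "has_velocity X T \<gamma> v \<Longrightarrow> 0 \<in> T"
  by (simp add: has_velocity_def chart_has_derivative_def)

lemma has_velocity_cong:
  assumes "has_velocity X T \<gamma> v" "\<And>t. t \<in> T \<Longrightarrow> \<gamma>' t = \<gamma> t"
  shows "has_velocity X T \<gamma>' v"
  using chart_has_derivative_cong[OF assms(1)[unfolded has_velocity_def] assms(2)]
    assms(2)[OF has_velocity_zero_in_domain[OF assms(1)]] by (simp add: has_velocity_def)

lemma has_velocity_const:
  assumes "smooth_manifold X" "p \<in> pts X" "0 \<in> T"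
  shows "has_velocity X T (\<lambda>t. p) 0"
  using chart_has_derivative_const[of 0 T "(UNIV, id)" p "chart_at X p"] chart_at_in_atlas[OF assms(1,2)] assms(3)
  by (simp add: has_velocity_def)

lemma chart_has_derivative_along_curve:
  assumes "has_velocity X T \<gamma> v" "chart_has_derivative (chart_at X (\<gamma> 0)) d S f (\<gamma> 0) D" "\<And>t. t \<in> T \<Longrightarrow> \<gamma> t \<in> S"
  shows "chart_has_derivative (UNIV, id) d T (\<lambda>t. f (\<gamma> t)) 0 (\<lambda>t. t *\<^sub>R D v)"
  using chart_has_derivative_compose[OF assms(1)[unfolded has_velocity_def] assms(2,3)]
    linear_scale[OF chart_has_derivative_linear[OF assms(2)]] by simp

lemma has_velocity_image:
  assumes "has_velocity X T \<gamma> v"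
    and "chart_has_derivative (chart_at X (\<gamma> 0)) (chart_at Y (f (\<gamma> 0))) S f (\<gamma> 0) D" "\<And>t. t \<in> T \<Longrightarrow> \<gamma> t \<in> S"
  shows "has_velocity Y T (\<lambda>t. f (\<gamma> t)) (D v)"
  using chart_has_derivative_along_curve[OF assms] by (simp add: has_velocity_def)

section \<open>Tangent maps of the groupoid operations\<close>

context
  fixes \<Gamma> :: "('g, 'e::real_inner, 'm, 'f::real_inner) groupoid"
  assumes lie: "lie_groupoid \<Gamma>"
begin

lemma arrows_manifold: "smooth_manifold (arrows \<Gamma>)" and objects_manifold: "smooth_manifold (objects \<Gamma>)"
  and gpd: "is_groupoid \<Gamma>"
  using lie by (simp_all add: lie_groupoid_def)

lemma src_in: "g \<in> pts (arrows \<Gamma>) \<Longrightarrow> src \<Gamma> g \<in> pts (objects \<Gamma>)"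
  and tgt_in: "g \<in> pts (arrows \<Gamma>) \<Longrightarrow> tgt \<Gamma> g \<in> pts (objects \<Gamma>)"
  and ident_in: "x \<in> pts (objects \<Gamma>) \<Longrightarrow> ident \<Gamma> x \<in> pts (arrows \<Gamma>)"
  and inv_in: "g \<in> pts (arrows \<Gamma>) \<Longrightarrow> inv_arr \<Gamma> g \<in> pts (arrows \<Gamma>)"
  using gpd unfolding is_groupoid_def by auto

lemma src_ident: "x \<in> pts (objects \<Gamma>) \<Longrightarrow> src \<Gamma> (ident \<Gamma> x) = x"
  and tgt_ident: "x \<in> pts (objects \<Gamma>) \<Longrightarrow> tgt \<Gamma> (ident \<Gamma> x) = x"
  and src_inv: "g \<in> pts (arrows \<Gamma>) \<Longrightarrow> src \<Gamma> (inv_arr \<Gamma> g) = tgt \<Gamma> g"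
  and tgt_inv: "g \<in> pts (arrows \<Gamma>) \<Longrightarrow> tgt \<Gamma> (inv_arr \<Gamma> g) = src \<Gamma> g"
  and mult_ident_left: "g \<in> pts (arrows \<Gamma>) \<Longrightarrow> mult \<Gamma> (ident \<Gamma> (src \<Gamma> g)) g = g"
  and mult_ident_right: "g \<in> pts (arrows \<Gamma>) \<Longrightarrow> mult \<Gamma> g (ident \<Gamma> (tgt \<Gamma> g)) = g"
  and mult_inv_right: "g \<in> pts (arrows \<Gamma>) \<Longrightarrow> mult \<Gamma> g (inv_arr \<Gamma> g) = ident \<Gamma> (src \<Gamma> g)"
  and mult_inv_left: "g \<in> pts (arrows \<Gamma>) \<Longrightarrow> mult \<Gamma> (inv_arr \<Gamma> g) g = ident \<Gamma> (tgt \<Gamma> g)"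
  and mult_in: "(g, h) \<in> composable \<Gamma> \<Longrightarrow> mult \<Gamma> g h \<in> pts (arrows \<Gamma>)"
  using gpd unfolding is_groupoid_def by blast+

lemma inv_ident: assumes "x \<in> pts (objects \<Gamma>)" shows "inv_arr \<Gamma> (ident \<Gamma> x) = ident \<Gamma> x"
  using mult_inv_left[OF ident_in[OF assms]] mult_ident_right[OF inv_in[OF ident_in[OF assms]]]
  by (simp add: tgt_inv ident_in src_ident tgt_ident assms)

lemmas groupoid_simps = src_in tgt_in ident_in inv_in src_ident tgt_ident src_inv tgt_inv
  mult_ident_left mult_ident_right mult_inv_right mult_inv_left inv_ident

lemma tangent_map_src:
  "g \<in> pts (arrows \<Gamma>) \<Longrightarrow> chart_has_derivative (chart_at (arrows \<Gamma>) g) (chart_at (objects \<Gamma>) (src \<Gamma> g))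
     (pts (arrows \<Gamma>)) (src \<Gamma>) g (tangent_map (arrows \<Gamma>) (objects \<Gamma>) (pts (arrows \<Gamma>)) (src \<Gamma>) g)"
  and tangent_map_tgt:
  "g \<in> pts (arrows \<Gamma>) \<Longrightarrow> chart_has_derivative (chart_at (arrows \<Gamma>) g) (chart_at (objects \<Gamma>) (tgt \<Gamma> g))
     (pts (arrows \<Gamma>)) (tgt \<Gamma>) g (tangent_map (arrows \<Gamma>) (objects \<Gamma>) (pts (arrows \<Gamma>)) (tgt \<Gamma>) g)"
  and tangent_map_ident:
  "x \<in> pts (objects \<Gamma>) \<Longrightarrow> chart_has_derivative (chart_at (objects \<Gamma>) x) (chart_at (arrows \<Gamma>) (ident \<Gamma> x))
     (pts (objects \<Gamma>)) (ident \<Gamma>) x (tangent_map (objects \<Gamma>) (arrows \<Gamma>) (pts (objects \<Gamma>)) (ident \<Gamma>) x)"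
  and tangent_map_inv:
  "g \<in> pts (arrows \<Gamma>) \<Longrightarrow> chart_has_derivative (chart_at (arrows \<Gamma>) g) (chart_at (arrows \<Gamma>) (inv_arr \<Gamma> g))
     (pts (arrows \<Gamma>)) (inv_arr \<Gamma>) g (tangent_map (arrows \<Gamma>) (arrows \<Gamma>) (pts (arrows \<Gamma>)) (inv_arr \<Gamma>) g)"
  using lie src_in[of g] tgt_in[of g] ident_in[of x] inv_in[of g] unfolding lie_groupoid_def submersion_def
  by (auto intro!: smooth_map_tangent_map)

lemma tangent_map_ident_tgt:
  assumes "x \<in> pts (objects \<Gamma>)"
  shows "chart_has_derivative (chart_at (arrows \<Gamma>) (ident \<Gamma> x)) (chart_at (arrows \<Gamma>) (ident \<Gamma> x))
     (pts (arrows \<Gamma>)) (ident \<Gamma> \<circ> tgt \<Gamma>) (ident \<Gamma> x)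
     (tangent_map (arrows \<Gamma>) (arrows \<Gamma>) (pts (arrows \<Gamma>)) (ident \<Gamma> \<circ> tgt \<Gamma>) (ident \<Gamma> x))"
proof -
  have e: "(ident \<Gamma> \<circ> tgt \<Gamma>) (ident \<Gamma> x) = ident \<Gamma> x" using assms by (simp add: groupoid_simps)
  have "\<exists>D. chart_has_derivative (chart_at (arrows \<Gamma>) (ident \<Gamma> x)) (chart_at (arrows \<Gamma>) (ident \<Gamma> x))
     (pts (arrows \<Gamma>)) (\<lambda>q. ident \<Gamma> (tgt \<Gamma> q)) (ident \<Gamma> x) D"
    using chart_has_derivative_compose[OF tangent_map_tgt tangent_map_ident, of "ident \<Gamma> x"] assms
    by (auto simp: groupoid_simps)
  then show ?thesis
    using tangent_mapI[of "arrows \<Gamma>" "ident \<Gamma> x" "arrows \<Gamma>" "ident \<Gamma> \<circ> tgt \<Gamma>" "pts (arrows \<Gamma>)"]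
    unfolding e by (auto simp: o_def)
qed

lemma prod_chart_in_atlas:
  "c \<in> atlas X \<Longrightarrow> d \<in> atlas Y \<Longrightarrow> prod_chart c d \<in> atlas (product_manifold X Y)"
  unfolding prod_chart_def product_manifold_def manifold.simps by blast

text \<open>
  The derivative of the multiplication need not be unique as a linear map, because the set of composable
  pairs need not be open. Any fixed choice \<open>D\<close> computes velocities of products of composable
  curves, and its linearity is all that is used besides.
\<close>

lemma mult_has_chart_derivative:
  assumes gh: "(g, h) \<in> composable \<Gamma>"
  shows "\<exists>D. chart_has_derivative (prod_chart (chart_at (arrows \<Gamma>) g) (chart_at (arrows \<Gamma>) h))
    (chart_at (arrows \<Gamma>) (mult \<Gamma> g h)) (composable \<Gamma>) (\<lambda>(g, h). mult \<Gamma> g h) (g, h) D"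
proof -
  have g: "g \<in> pts (arrows \<Gamma>)" and h: "h \<in> pts (arrows \<Gamma>)" using gh by (auto simp: composable_def)
  note cg = chart_at_in_atlas[OF arrows_manifold g] and ch = chart_at_in_atlas[OF arrows_manifold h]
    and cm = chart_at_in_atlas[OF arrows_manifold mult_in[OF gh]]
  show ?thesis
  proof (rule smooth_map_imp_chart_has_derivative)
    show "smooth_map (product_manifold (arrows \<Gamma>) (arrows \<Gamma>)) (arrows \<Gamma>) (composable \<Gamma>) (\<lambda>(g, h). mult \<Gamma> g h)"
      using lie by (simp add: lie_groupoid_def)
    show "prod_chart (chart_at (arrows \<Gamma>) g) (chart_at (arrows \<Gamma>) h) \<in> atlas (product_manifold (arrows \<Gamma>) (arrows \<Gamma>))"
      using cg(1) ch(1) by (rule prod_chart_in_atlas)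
    show "inj_on (snd (prod_chart (chart_at (arrows \<Gamma>) g) (chart_at (arrows \<Gamma>) h)))
        (fst (prod_chart (chart_at (arrows \<Gamma>) g) (chart_at (arrows \<Gamma>) h)))"
      using cg ch by (auto simp: prod_chart_def intro: map_prod_inj_on)
  qed (use gh cg ch cm in \<open>auto simp: prod_chart_def\<close>)
qed

lemma has_velocity_mult:
  assumes D: "chart_has_derivative (prod_chart (chart_at (arrows \<Gamma>) (a 0)) (chart_at (arrows \<Gamma>) (b 0)))
      (chart_at (arrows \<Gamma>) (mult \<Gamma> (a 0) (b 0))) (composable \<Gamma>) (\<lambda>(g, h). mult \<Gamma> g h) (a 0, b 0) D"
    and a: "has_velocity (arrows \<Gamma>) T a u" and b: "has_velocity (arrows \<Gamma>) T b v"
    and ab: "\<And>t. t \<in> T \<Longrightarrow> (a t, b t) \<in> composable \<Gamma>"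
  shows "has_velocity (arrows \<Gamma>) T (\<lambda>t. mult \<Gamma> (a t) (b t)) (D (u, v))"
proof -
  have "D (t *\<^sub>R u, t *\<^sub>R v) = t *\<^sub>R D (u, v)" for t
    using linear_scale[OF chart_has_derivative_linear[OF D], of t "(u, v)"] by simp
  then show ?thesis
    using chart_has_derivative_compose[OF chart_has_derivative_Pair[OF a[unfolded has_velocity_def]
        b[unfolded has_velocity_def]] D ab]
    by (simp add: has_velocity_def)
qed

lemma algebroid_fibre_is_velocity:
  assumes x: "x \<in> pts (objects \<Gamma>)" and X: "X \<in> algebroid_fibre \<Gamma> x"
  obtains k T where "open T" "k 0 = ident \<Gamma> x" "\<And>t. t \<in> T \<Longrightarrow> k t \<in> src_fibre \<Gamma> x"
    "has_velocity (arrows \<Gamma>) T k X"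
proof -
  have sub: "submersion (arrows \<Gamma>) (objects \<Gamma>) (src \<Gamma>)" using lie by (simp add: lie_groupoid_def)
  have v: "tangent_map (arrows \<Gamma>) (objects \<Gamma>) (pts (arrows \<Gamma>)) (src \<Gamma>) (ident \<Gamma> x) X = 0"
    using X by (simp add: algebroid_fibre_def)
  have sx: "src \<Gamma> (ident \<Gamma> x) \<in> pts (objects \<Gamma>)" using x by (simp add: groupoid_simps)
  show ?thesis
  proof (rule submersion_kernel_is_velocity[OF arrows_manifold objects_manifold sub ident_in[OF x] sx v])
    fix k :: "real \<Rightarrow> 'g" and T
    assume "open T" "k 0 = ident \<Gamma> x"
      "\<And>t. t \<in> T \<Longrightarrow> k t \<in> pts (arrows \<Gamma>) \<and> src \<Gamma> (k t) = src \<Gamma> (ident \<Gamma> x)"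
      "chart_has_derivative (UNIV, id) (chart_at (arrows \<Gamma>) (ident \<Gamma> x)) T k 0 (\<lambda>t. t *\<^sub>R X)"
    then show thesis
      using x by (intro that[of T k]) (simp_all add: has_velocity_def src_fibre_def groupoid_simps)
  qed
qed

text \<open>
  Let \<open>D\<close> be the derivative of the multiplication at \<open>(\<epsilon>(x), \<epsilon>(x))\<close> and \<open>k\<close> a curve in the
  source fibre with velocity \<open>X\<close>. The product of \<open>k\<close> and \<open>i(k)\<close> is constant, so
  \<open>D(X, T i X) = 0\<close>. The product of \<open>k\<close> and \<open>\<epsilon>(\<beta>(k))\<close> is \<open>k\<close>, so
  \<open>D(X, T(\<epsilon> \<circ> \<beta>) X) = X\<close>. Subtracting, \<open>D(0, W) = -X\<close> for \<open>W = T i X - T(\<epsilon> \<circ> \<beta>) X\<close>. Both terms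
  of \<open>W\<close> have the image \<open>T \<beta> X\<close> under \<open>T \<alpha>\<close>, so \<open>W\<close> lies in the algebroid fibre again and
  is the velocity of some curve \<open>w\<close> in the source fibre; from \<open>\<epsilon>(x) w = w\<close> it follows that
  \<open>D(0, W) = W\<close>.
\<close>

lemma tangent_map_inv_on_algebroid:
  assumes x: "x \<in> pts (objects \<Gamma>)" and X: "X \<in> algebroid_fibre \<Gamma> x"
  shows "tangent_map (arrows \<Gamma>) (arrows \<Gamma>) (pts (arrows \<Gamma>)) (inv_arr \<Gamma>) (ident \<Gamma> x) X =
    tangent_map (arrows \<Gamma>) (arrows \<Gamma>) (pts (arrows \<Gamma>)) (ident \<Gamma> \<circ> tgt \<Gamma>) (ident \<Gamma> x) X - X"
proof -
  let ?G = "arrows \<Gamma>" and ?M = "objects \<Gamma>" and ?e = "ident \<Gamma> x"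
  let ?I = "tangent_map ?G ?G (pts ?G) (inv_arr \<Gamma>) ?e"
    and ?E = "tangent_map ?G ?G (pts ?G) (ident \<Gamma> \<circ> tgt \<Gamma>) ?e"
  let ?A = "tangent_map ?G ?M (pts ?G) (src \<Gamma>) ?e" and ?B = "tangent_map ?G ?M (pts ?G) (tgt \<Gamma>) ?e"
  have e: "?e \<in> pts ?G" "src \<Gamma> ?e = x" "tgt \<Gamma> ?e = x" "inv_arr \<Gamma> ?e = ?e" "mult \<Gamma> ?e ?e = ?e"
    "(ident \<Gamma> \<circ> tgt \<Gamma>) ?e = ?e"
    using x mult_ident_left[of ?e] by (simp_all add: groupoid_simps)
  then have ee: "(?e, ?e) \<in> composable \<Gamma>" by (simp add: composable_def)
  obtain D where D: "chart_has_derivative (prod_chart (chart_at ?G ?e) (chart_at ?G ?e))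
      (chart_at ?G (mult \<Gamma> ?e ?e)) (composable \<Gamma>) (\<lambda>(g, h). mult \<Gamma> g h) (?e, ?e) D"
    using mult_has_chart_derivative[OF ee] by blast
  have linD: "linear D" using D by (rule chart_has_derivative_linear)
  obtain k T where k: "open T" "k 0 = ?e" "\<And>t. t \<in> T \<Longrightarrow> k t \<in> src_fibre \<Gamma> x" "has_velocity ?G T k X"
    using algebroid_fibre_is_velocity[OF x X] by metis
  have kG: "k t \<in> pts ?G" "src \<Gamma> (k t) = x" if "t \<in> T" for t using k(3)[OF that] by (auto simp: src_fibre_def)
  have T0: "0 \<in> T" using has_velocity_zero_in_domain[OF k(4)] .
  have I: "has_velocity ?G T (\<lambda>t. inv_arr \<Gamma> (k t)) (?I X)"
    by (rule has_velocity_image[OF k(4) _ kG(1)]) (use tangent_map_inv[OF e(1)] k(2) in simp)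
  have E: "has_velocity ?G T (\<lambda>t. (ident \<Gamma> \<circ> tgt \<Gamma>) (k t)) (?E X)"
    by (rule has_velocity_image[where f = "ident \<Gamma> \<circ> tgt \<Gamma>", OF k(4) _ kG(1)])
      (use tangent_map_ident_tgt[OF x] in \<open>simp only: k(2) e(6)\<close>)
  have B: "has_velocity ?M T (\<lambda>t. tgt \<Gamma> (k t)) (?B X)"
    by (rule has_velocity_image[OF k(4) _ kG(1)]) (use tangent_map_tgt[OF e(1)] k(2) in simp)
  have "has_velocity ?M T (\<lambda>t. src \<Gamma> (inv_arr \<Gamma> (k t))) (?A (?I X))"
    by (rule has_velocity_image[OF I, where S = "pts ?G"])
      (use tangent_map_src[OF e(1)] k(2) e kG in \<open>auto simp: groupoid_simps\<close>)
  then have "has_velocity ?M T (\<lambda>t. tgt \<Gamma> (k t)) (?A (?I X))"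
    by (rule has_velocity_cong) (use kG in \<open>simp add: groupoid_simps\<close>)
  then have AI: "?A (?I X) = ?B X" using B k(1) by (rule has_velocity_unique)
  have "has_velocity ?M T (\<lambda>t. src \<Gamma> ((ident \<Gamma> \<circ> tgt \<Gamma>) (k t))) (?A (?E X))"
    by (rule has_velocity_image[OF E, where S = "pts ?G"])
      (use tangent_map_src[OF e(1)] k(2) e kG in \<open>auto simp: groupoid_simps\<close>)
  then have "has_velocity ?M T (\<lambda>t. tgt \<Gamma> (k t)) (?A (?E X))"
    by (rule has_velocity_cong) (use kG in \<open>simp add: groupoid_simps\<close>)
  then have AE: "?A (?E X) = ?B X" using B k(1) by (rule has_velocity_unique)
  define W where "W = ?I X - ?E X"
  have "linear ?A" using tangent_map_src[OF e(1)] by (rule chart_has_derivative_linear)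
  then have "W \<in> algebroid_fibre \<Gamma> x"
    using AI AE by (simp add: algebroid_fibre_def W_def linear_diff)
  then obtain w T' where w: "open T'" "w 0 = ?e" "\<And>t. t \<in> T' \<Longrightarrow> w t \<in> src_fibre \<Gamma> x" "has_velocity ?G T' w W"
    using algebroid_fibre_is_velocity[OF x] by metis
  have T0': "0 \<in> T'" using has_velocity_zero_in_domain[OF w(4)] .
  \<comment> \<open>\<open>k i(k) = \<epsilon>(x)\<close>\<close>
  have "has_velocity ?G T (\<lambda>t. mult \<Gamma> (k t) (inv_arr \<Gamma> (k t))) (D (X, ?I X))"
    by (rule has_velocity_mult[OF _ k(4) I])
      (use D k(2) e kG in \<open>auto simp: composable_def groupoid_simps\<close>)
  then have "has_velocity ?G T (\<lambda>t. ?e) (D (X, ?I X))"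
    by (rule has_velocity_cong) (use kG in \<open>simp add: groupoid_simps\<close>)
  then have 1: "D (X, ?I X) = 0"
    using has_velocity_const[OF arrows_manifold e(1) T0] k(1) by (rule has_velocity_unique)
  \<comment> \<open>\<open>k \<epsilon>(\<beta>(k)) = k\<close>\<close>
  have "has_velocity ?G T (\<lambda>t. mult \<Gamma> (k t) ((ident \<Gamma> \<circ> tgt \<Gamma>) (k t))) (D (X, ?E X))"
    by (rule has_velocity_mult[OF _ k(4) E])
      (use D k(2) e kG in \<open>auto simp: composable_def groupoid_simps\<close>)
  then have "has_velocity ?G T k (D (X, ?E X))"
    by (rule has_velocity_cong) (use kG in \<open>simp add: groupoid_simps\<close>)
  then have 2: "D (X, ?E X) = X" using k(4) k(1) by (rule has_velocity_unique)
  \<comment> \<open>\<open>\<epsilon>(x) w = w\<close>\<close>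
  have "has_velocity ?G T' (\<lambda>t. mult \<Gamma> ?e (w t)) (D (0, W))"
    by (rule has_velocity_mult[OF _ has_velocity_const[OF arrows_manifold e(1) T0'] w(4)])
      (use D w e in \<open>auto simp: composable_def src_fibre_def\<close>)
  then have "has_velocity ?G T' w (D (0, W))"
    by (rule has_velocity_cong) (use w(3) mult_ident_left in \<open>force simp: src_fibre_def\<close>)
  then have 3: "D (0, W) = W" using w(4) w(1) by (rule has_velocity_unique)
  have "(0, W) = (X, ?I X) - (X, ?E X)" by (simp add: W_def)
  then have "D (0, W) = - X" using 1 2 linear_diff[OF linD] by (metis diff_0)
  then have "?I X - ?E X = - X" using 3 unfolding W_def by (simp only:)
  then have "?I X = - X + ?E X" by (simp only: diff_eq_eq)
  then show ?thesis by (simp only: uminus_add_conv_diff)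
qed

text \<open>
  Translations are restrictions of the multiplication to a slice, and so inherit derivatives
  within the fibres by the chain rule.
\<close>

lemma tangent_map_ltrans:
  assumes g: "g \<in> pts (arrows \<Gamma>)"
  defines "x \<equiv> tgt \<Gamma> g"
  shows "chart_has_derivative (chart_at (arrows \<Gamma>) (ident \<Gamma> x)) (chart_at (arrows \<Gamma>) g) (src_fibre \<Gamma> x)
    (ltrans \<Gamma> g) (ident \<Gamma> x) (tangent_map (arrows \<Gamma>) (arrows \<Gamma>) (src_fibre \<Gamma> x) (ltrans \<Gamma> g) (ident \<Gamma> x))"
proof -
  let ?G = "arrows \<Gamma>" and ?e = "ident \<Gamma> x"
  have x: "x \<in> pts (objects \<Gamma>)" using g by (simp add: x_def groupoid_simps)
  have ge: "(g, ?e) \<in> composable \<Gamma>" and e: "?e \<in> pts ?G" "?e \<in> src_fibre \<Gamma> x" and m: "mult \<Gamma> g ?e = g"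
    using g x by (simp_all add: composable_def groupoid_simps src_fibre_def) (simp_all add: x_def groupoid_simps g)
  obtain D where D: "chart_has_derivative (prod_chart (chart_at ?G g) (chart_at ?G ?e)) (chart_at ?G g)
      (composable \<Gamma>) (\<lambda>(g, h). mult \<Gamma> g h) (g, ?e) D"
    using mult_has_chart_derivative[OF ge] m by auto
  note ce = chart_at_in_atlas[OF arrows_manifold e(1)] and cg = chart_at_in_atlas[OF arrows_manifold g]
  have "chart_has_derivative (chart_at ?G ?e) (prod_chart (chart_at ?G g) (chart_at ?G ?e)) (src_fibre \<Gamma> x)
      (\<lambda>k. (g, k)) ?e (\<lambda>v. (0, v))"
    by (intro chart_has_derivative_Pair chart_has_derivative_const chart_has_derivative_ident e ce cg)
  from chart_has_derivative_compose[OF this D] g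
  have "chart_has_derivative (chart_at ?G ?e) (chart_at ?G (ltrans \<Gamma> g ?e)) (src_fibre \<Gamma> x)
      (ltrans \<Gamma> g) ?e (\<lambda>v. D (0, v))"
    by (simp add: ltrans_def[abs_def] m) (simp add: composable_def src_fibre_def x_def)
  from tangent_mapI[where f = "ltrans \<Gamma> g", OF this] show ?thesis by (simp add: ltrans_def m)
qed

lemma tangent_map_rtrans:
  assumes h: "h \<in> pts (arrows \<Gamma>)"
  defines "x \<equiv> src \<Gamma> h"
  shows "chart_has_derivative (chart_at (arrows \<Gamma>) (ident \<Gamma> x)) (chart_at (arrows \<Gamma>) h) (tgt_fibre \<Gamma> x)
    (rtrans \<Gamma> h) (ident \<Gamma> x) (tangent_map (arrows \<Gamma>) (arrows \<Gamma>) (tgt_fibre \<Gamma> x) (rtrans \<Gamma> h) (ident \<Gamma> x))"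
proof -
  let ?G = "arrows \<Gamma>" and ?e = "ident \<Gamma> x"
  have x: "x \<in> pts (objects \<Gamma>)" using h by (simp add: x_def groupoid_simps)
  have eh: "(?e, h) \<in> composable \<Gamma>" and e: "?e \<in> pts ?G" "?e \<in> tgt_fibre \<Gamma> x" and m: "mult \<Gamma> ?e h = h"
    using h x by (simp_all add: composable_def groupoid_simps tgt_fibre_def) (simp_all add: x_def groupoid_simps h)
  obtain D where D: "chart_has_derivative (prod_chart (chart_at ?G ?e) (chart_at ?G h)) (chart_at ?G h)
      (composable \<Gamma>) (\<lambda>(g, h). mult \<Gamma> g h) (?e, h) D"
    using mult_has_chart_derivative[OF eh] m by auto
  note ce = chart_at_in_atlas[OF arrows_manifold e(1)] and ch = chart_at_in_atlas[OF arrows_manifold h]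
  have "chart_has_derivative (chart_at ?G ?e) (prod_chart (chart_at ?G ?e) (chart_at ?G h)) (tgt_fibre \<Gamma> x)
      (\<lambda>k. (k, h)) ?e (\<lambda>v. (v, 0))"
    by (intro chart_has_derivative_Pair chart_has_derivative_const chart_has_derivative_ident e ce ch)
  from chart_has_derivative_compose[OF this D] h
  have "chart_has_derivative (chart_at ?G ?e) (chart_at ?G (rtrans \<Gamma> h ?e)) (tgt_fibre \<Gamma> x)
      (rtrans \<Gamma> h) ?e (\<lambda>v. D (v, 0))"
    by (simp add: rtrans_def[abs_def] m) (simp add: composable_def tgt_fibre_def x_def)
  from tangent_mapI[where f = "rtrans \<Gamma> h", OF this] show ?thesis by (simp add: rtrans_def m)
qed

text \<open>
  The chain rule gives one derivative of the function on the source fibre, the differential is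
  possibly another one; they agree on \<open>X\<close> because \<open>X\<close> is the velocity of a curve in the fibre.
  The second summand is rewritten by the formula for the tangent map of the inversion and the
  linearity of \<open>dL(h) \<circ> T r\<^sub>h\<close>.
\<close>

lemma differential_of_discrete_action:
  assumes L: "smooth_map (arrows \<Gamma>) vector_manifold (pts (arrows \<Gamma>)) L"
    and gh: "(g, h) \<in> composable \<Gamma>" and X: "X \<in> algebroid_fibre \<Gamma> (tgt \<Gamma> g)"
  defines "x \<equiv> tgt \<Gamma> g"
  shows "differential (arrows \<Gamma>) (src_fibre \<Gamma> x)
      (\<lambda>k. (L \<circ> ltrans \<Gamma> g) k + (L \<circ> rtrans \<Gamma> h \<circ> inv_arr \<Gamma>) k) (ident \<Gamma> x) X =
    differential (arrows \<Gamma>) (pts (arrows \<Gamma>)) L g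
      (tangent_map (arrows \<Gamma>) (arrows \<Gamma>) (src_fibre \<Gamma> x) (ltrans \<Gamma> g) (ident \<Gamma> x) X) -
    differential (arrows \<Gamma>) (pts (arrows \<Gamma>)) L h
      (tangent_map (arrows \<Gamma>) (arrows \<Gamma>) (tgt_fibre \<Gamma> x) (rtrans \<Gamma> h) (ident \<Gamma> x)
        (X - tangent_map (arrows \<Gamma>) (arrows \<Gamma>) (pts (arrows \<Gamma>)) (ident \<Gamma> \<circ> tgt \<Gamma>) (ident \<Gamma> x) X))"
proof -
  let ?G = "arrows \<Gamma>" and ?e = "ident \<Gamma> x"
  let ?f = "\<lambda>k. (L \<circ> ltrans \<Gamma> g) k + (L \<circ> rtrans \<Gamma> h \<circ> inv_arr \<Gamma>) k"
  let ?dg = "differential ?G (pts ?G) L g" and ?dh = "differential ?G (pts ?G) L h"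
  let ?l = "tangent_map ?G ?G (src_fibre \<Gamma> x) (ltrans \<Gamma> g) ?e"
  let ?r = "tangent_map ?G ?G (tgt_fibre \<Gamma> x) (rtrans \<Gamma> h) ?e"
  let ?E = "tangent_map ?G ?G (pts ?G) (ident \<Gamma> \<circ> tgt \<Gamma>) ?e"
  let ?I = "tangent_map ?G ?G (pts ?G) (inv_arr \<Gamma>) ?e"
  have g: "g \<in> pts ?G" and h: "h \<in> pts ?G" and xh: "x = src \<Gamma> h"
    using gh by (auto simp: composable_def x_def)
  have x: "x \<in> pts (objects \<Gamma>)" using g by (simp add: x_def groupoid_simps)
  have e: "?e \<in> pts ?G" "?e \<in> src_fibre \<Gamma> x" "inv_arr \<Gamma> ?e = ?e" "mult \<Gamma> g ?e = g" "mult \<Gamma> ?e h = h"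
    using x mult_ident_right[OF g] mult_ident_left[OF h]
    by (auto simp: groupoid_simps src_fibre_def x_def[symmetric] xh[symmetric])
  have dg: "chart_has_derivative (chart_at ?G g) (UNIV, id) (pts ?G) L (ltrans \<Gamma> g ?e) ?dg"
    using smooth_map_differential[OF arrows_manifold L g] e by (simp add: ltrans_def)
  have dh: "chart_has_derivative (chart_at ?G h) (UNIV, id) (pts ?G) L (rtrans \<Gamma> h ?e) ?dh"
    using smooth_map_differential[OF arrows_manifold L h] e by (simp add: rtrans_def)
  have l: "chart_has_derivative (chart_at ?G ?e) (UNIV, id) (src_fibre \<Gamma> x) (\<lambda>k. L (ltrans \<Gamma> g k)) ?e
      (\<lambda>v. ?dg (?l v))"
  proof (rule chart_has_derivative_compose[where f = "ltrans \<Gamma> g", OF _ dg])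
    show "chart_has_derivative (chart_at ?G ?e) (chart_at ?G g) (src_fibre \<Gamma> x) (ltrans \<Gamma> g) ?e ?l"
      using tangent_map_ltrans[OF g] by (simp add: x_def)
    show "ltrans \<Gamma> g k \<in> pts ?G" if "k \<in> src_fibre \<Gamma> x" for k
      using that g mult_in[of g k] by (simp add: ltrans_def src_fibre_def composable_def x_def)
  qed
  have i: "chart_has_derivative (chart_at ?G ?e) (chart_at ?G ?e) (src_fibre \<Gamma> x) (inv_arr \<Gamma>) ?e ?I"
    using chart_has_derivative_subset[OF tangent_map_inv[OF e(1)] _ e(2)] e(3)
    by (auto simp: src_fibre_def)
  have rt: "chart_has_derivative (chart_at ?G ?e) (chart_at ?G h) (tgt_fibre \<Gamma> x) (rtrans \<Gamma> h) ?e ?r"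
    using tangent_map_rtrans[OF h] by (simp add: xh)
  have rh: "chart_has_derivative (chart_at ?G ?e) (UNIV, id) (tgt_fibre \<Gamma> x) (\<lambda>k. L (rtrans \<Gamma> h k)) ?e
      (\<lambda>v. ?dh (?r v))"
  proof (rule chart_has_derivative_compose[where f = "rtrans \<Gamma> h", OF rt dh])
    show "rtrans \<Gamma> h k \<in> pts ?G" if "k \<in> tgt_fibre \<Gamma> x" for k
      using that h mult_in[of k h] by (simp add: rtrans_def tgt_fibre_def composable_def xh)
  qed
  have r: "chart_has_derivative (chart_at ?G ?e) (UNIV, id) (src_fibre \<Gamma> x)
      (\<lambda>k. L (rtrans \<Gamma> h (inv_arr \<Gamma> k))) ?e (\<lambda>v. ?dh (?r (?I v)))"
    by (rule chart_has_derivative_compose[OF i, where S' = "tgt_fibre \<Gamma> x"])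
      (use rh e(3) in \<open>auto simp: tgt_fibre_def src_fibre_def groupoid_simps\<close>)
  have f: "chart_has_derivative (chart_at ?G ?e) (UNIV, id) (src_fibre \<Gamma> x) ?f ?e
      (\<lambda>v. ?dg (?l v) + ?dh (?r (?I v)))"
    using chart_has_derivative_add[OF l r] by (simp add: o_def)
  then have f': "chart_has_derivative (chart_at ?G ?e) (UNIV, id) (src_fibre \<Gamma> x) ?f ?e
      (differential ?G (src_fibre \<Gamma> x) ?f ?e)"
    using tangent_mapI[where Y = vector_manifold] by (simp add: chart_at_vector_manifold)
  obtain k T where k: "open T" "k 0 = ?e" "\<And>t. t \<in> T \<Longrightarrow> k t \<in> src_fibre \<Gamma> x" "has_velocity ?G T k X"
    using algebroid_fibre_is_velocity[OF x] X unfolding x_def by metis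
  have along: "chart_has_derivative (UNIV, id) (UNIV, id) T (\<lambda>t. ?f (k t)) 0 (\<lambda>t. t *\<^sub>R D X)"
    if "chart_has_derivative (chart_at ?G ?e) (UNIV, id) (src_fibre \<Gamma> x) ?f ?e D" for D
    by (rule chart_has_derivative_along_curve[where f = ?f, OF k(4) _ k(3)]) (use that in \<open>simp only: k(2)\<close>)
  have "(\<lambda>t. t *\<^sub>R differential ?G (src_fibre \<Gamma> x) ?f ?e X) = (\<lambda>t. t *\<^sub>R (?dg (?l X) + ?dh (?r (?I X))))"
    by (rule chart_has_derivative_unique_open[OF along[OF f'] along[OF f] k(1)])
  from fun_cong[OF this, of 1]
  have "differential ?G (src_fibre \<Gamma> x) ?f ?e X = ?dg (?l X) + ?dh (?r (?I X))"
    by (simp only: scaleR_one)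
  also have "?I X = - (X - ?E X)"
    using tangent_map_inv_on_algebroid[OF x] X by (simp add: x_def)
  also have "?dh (?r (- (X - ?E X))) = - ?dh (?r (X - ?E X))"
    using linear_neg[OF chart_has_derivative_linear[OF rh]] .
  finally show ?thesis by (simp only: add_uminus_conv_diff)
qed

end

section \<open>Discrete Euler-Lagrange equations and the first integrability step\<close>

lemma restrict_eq_iff: "restrict f A = restrict g A \<longleftrightarrow> (\<forall>x\<in>A. f x = g x)"
  by (auto simp: restrict_def fun_eq_iff)

theorem proposition4p6:
  fixes \<Gamma> :: "('g, 'e::real_inner, 'm, 'f::real_inner) groupoid"
    and L :: "'g \<Rightarrow> real" and Mc :: "'g set" and Dc :: "'m \<Rightarrow> 'e set"
  assumes "lie_groupoid \<Gamma>"
    and "discrete_nonholonomic_system \<Gamma> L Mc Dc"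
  shows "let dL = covector_d (arrows \<Gamma>) L;
             S = dL ` Mc;
             S1 = forward_step (cotangent_bundle (arrows \<Gamma>)) (cot_src_on \<Gamma> Dc) (cot_tgt_on \<Gamma> Dc) S;
             R = {(g, h) \<in> composable \<Gamma> \<inter> (Mc \<times> Mc). cot_tgt_on \<Gamma> Dc (dL g) = cot_src_on \<Gamma> Dc (dL h)}
         in S1 = {dL g | g. g \<in> Mc \<and> (\<exists>h\<in>Mc. (g, h) \<in> composable \<Gamma> \<and> solves_DNEL \<Gamma> L Mc Dc g h)}
          \<and> {(g, h) \<in> composable \<Gamma> \<inter> (Mc \<times> Mc). solves_DNEL \<Gamma> L Mc Dc g h} = R
          \<and> S1 = {dL g | g. \<exists>h. (g, h) \<in> R}"
proof -
  let ?G = "arrows \<Gamma>" and ?dL = "covector_d (arrows \<Gamma>) L"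
  have L: "smooth_map ?G vector_manifold (pts ?G) L" and Mc: "Mc \<subseteq> pts ?G"
    and Dc: "\<And>x. x \<in> pts (objects \<Gamma>) \<Longrightarrow> Dc x \<subseteq> algebroid_fibre \<Gamma> x"
    using assms(2) unfolding discrete_nonholonomic_system_def embedded_submanifold_def vector_subbundle_def
    by blast+
  have solves: "solves_DNEL \<Gamma> L Mc Dc g h \<longleftrightarrow> cot_tgt_on \<Gamma> Dc (?dL g) = cot_src_on \<Gamma> Dc (?dL h)"
    if gh: "(g, h) \<in> composable \<Gamma> \<inter> (Mc \<times> Mc)" for g h
  proof -
    let ?x = "tgt \<Gamma> g"
    have "?x \<in> pts (objects \<Gamma>)"
      by (rule tgt_in[OF assms(1)]) (use gh in \<open>simp add: composable_def\<close>)
    then have x: "src \<Gamma> h = ?x" "?x \<in> pts (objects \<Gamma>)"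
      using gh by (simp_all add: composable_def)
    let ?l = "\<lambda>X. differential ?G (pts ?G) L g
      (tangent_map ?G ?G (src_fibre \<Gamma> ?x) (ltrans \<Gamma> g) (ident \<Gamma> ?x) X)"
    let ?r = "\<lambda>X. differential ?G (pts ?G) L h
      (tangent_map ?G ?G (tgt_fibre \<Gamma> ?x) (rtrans \<Gamma> h) (ident \<Gamma> ?x)
        (X - tangent_map ?G ?G (pts ?G) (ident \<Gamma> \<circ> tgt \<Gamma>) (ident \<Gamma> ?x) X))"
    have "cot_tgt_on \<Gamma> Dc (?dL g) = (?x, restrict ?l (Dc ?x))"
      using Dc[OF x(2)] by (auto simp: cot_tgt_on_def cot_tgt_def dual_incl_def covector_d_def restrict_def fun_eq_iff)
    moreover have "cot_src_on \<Gamma> Dc (?dL h) = (?x, restrict ?r (Dc ?x))"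
      using Dc[OF x(2)] x(1)
      by (auto simp: cot_src_on_def cot_src_def dual_incl_def covector_d_def restrict_def fun_eq_iff)
    moreover have "solves_DNEL \<Gamma> L Mc Dc g h \<longleftrightarrow> (\<forall>X\<in>Dc ?x. ?l X - ?r X = 0)"
    proof -
      have "differential ?G (src_fibre \<Gamma> ?x) (\<lambda>k. (L \<circ> ltrans \<Gamma> g) k + (L \<circ> rtrans \<Gamma> h \<circ> inv_arr \<Gamma>) k)
          (ident \<Gamma> ?x) X = ?l X - ?r X" if "X \<in> Dc ?x" for X
        using gh Dc[OF x(2)] that by (intro differential_of_discrete_action[OF assms(1) L]) blast+
      then show ?thesis using gh unfolding solves_DNEL_def by (simp only: simp_thms cong: ball_cong)
    qed
    moreover have "restrict ?l (Dc ?x) = restrict ?r (Dc ?x) \<longleftrightarrow> (\<forall>X\<in>Dc ?x. ?l X = ?r X)"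
      by (rule restrict_eq_iff)
    ultimately show ?thesis by (simp only: prod.inject simp_thms right_minus_eq)
  qed
  \<comment> \<open>Points of the dual bundle carry their base points, and these are \<open>\<beta>(g)\<close> and \<open>\<alpha>(h)\<close>.\<close>
  have comp: "(g, h) \<in> composable \<Gamma>" if "g \<in> Mc" "h \<in> Mc" "cot_tgt_on \<Gamma> Dc (?dL g) = cot_src_on \<Gamma> Dc (?dL h)" for g h
    using that Mc by (auto simp: composable_def cot_tgt_on_def cot_src_on_def cot_tgt_def cot_src_def
        dual_incl_def covector_d_def)
  have cot: "?dL g \<in> cotangent_bundle ?G" if "g \<in> Mc" for g
  proof -
    have g: "g \<in> pts ?G" using that Mc by blast
    show ?thesis
      using g chart_has_derivative_linear[OF smooth_map_differential[OF arrows_manifold[OF assms(1)] L g]]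
      by (simp add: cotangent_bundle_def covector_d_def)
  qed
  have S1: "forward_step (cotangent_bundle ?G) (cot_src_on \<Gamma> Dc) (cot_tgt_on \<Gamma> Dc) (?dL ` Mc) =
      {?dL g | g. g \<in> Mc \<and> (\<exists>h\<in>Mc. cot_tgt_on \<Gamma> Dc (?dL g) = cot_src_on \<Gamma> Dc (?dL h))}"
    unfolding forward_step_def using cot by blast
  have 1: "forward_step (cotangent_bundle ?G) (cot_src_on \<Gamma> Dc) (cot_tgt_on \<Gamma> Dc) (?dL ` Mc) =
      {?dL g | g. g \<in> Mc \<and> (\<exists>h\<in>Mc. (g, h) \<in> composable \<Gamma> \<and> solves_DNEL \<Gamma> L Mc Dc g h)}"
    unfolding S1 using solves comp by blast
  have 2: "{(g, h) \<in> composable \<Gamma> \<inter> (Mc \<times> Mc). solves_DNEL \<Gamma> L Mc Dc g h} =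
      {(g, h) \<in> composable \<Gamma> \<inter> (Mc \<times> Mc). cot_tgt_on \<Gamma> Dc (?dL g) = cot_src_on \<Gamma> Dc (?dL h)}"
    using solves by auto
  have 3: "forward_step (cotangent_bundle ?G) (cot_src_on \<Gamma> Dc) (cot_tgt_on \<Gamma> Dc) (?dL ` Mc) =
      {?dL g | g. \<exists>h. (g, h) \<in> {(g, h) \<in> composable \<Gamma> \<inter> (Mc \<times> Mc).
        cot_tgt_on \<Gamma> Dc (?dL g) = cot_src_on \<Gamma> Dc (?dL h)}}"
    unfolding S1 using comp by blast
  show ?thesis unfolding Let_def using 1 2 3 by blast
qed

end
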